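(* Let $X$ be a rectifiable Tychonoff space which is both an $\aleph$-space and a $k_{\mathbb R}$-space. If $X$ contains no strong $\mathrm{Fin}^\omega$-fan, then $X$ is either metrizable or is a topological sum (disjoint topological union) of cosmic $k_\omega$-spaces.
   Context: A topological space $X$ is rectifiable if there exist a point $e\in X$ and a homeomorphism $h:X\times X\to X\times X$ such that $h(\Delta_X)=X\times\{e\}$, where $\Delta_X=\{(x,x):x\in X\}$, and $h(\{x\}\times X)=\{x\}\times X$ for all $x\in X$. "Regular" includes $T_1$. A family $\mathcal N$ of subsets of $X$ is a network if for each $x\in X$ and each neighborhood $O_x$ of $x$ there is $N\in\mathcal N$ with $x\in N\subset O_x$; it is a $k$-network if for each open $U\subset X$ and compact $K\subset U$ there is a finite $\mathcal F\subset\mathcal N$ with $K\subset\bigcup\mathcal F\subset U$. A regular space is cosmic if it has a countable network; it is an $\aleph$-space if it has a $k$-network which is a countable union of locally finite families. $X$ is a $k_{\mathbb R}$-space if every function $f:X\to\mathbb R$ whose restriction to each compact subset of $X$ is continuous is continuous. $X$ is a $k_\omega$-space if it has a countable cover $\mathcal K$ by compact subsets such that a set $F\subset X$ is closed in $X$ iff $F\cap K$ is closed in $K$ for every $K\in\mathcal K$. A family $(F_n)_{n\in\omega}$ of subsets of $X$ is locally finite if each point of $X$ has a neighborhood meeting $F_n$ for only finitely many $n$; it is compact-finite if each compact subset of $X$ meets $F_n$ for only finitely many $n$. A set $U\subset X$ is $\mathbb R$-open if for each $x\in U$ there is a continuous $f:X\to[0,1]$ with $f(x)=1$ and $f(X\setminus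 U)\subset\{0\}$. A $\mathrm{Fin}^\omega$-fan in $X$ is a family $(F_n)_{n\in\omega}$ of finite subsets of $X$ that is compact-finite but not locally finite; it is strong if each $F_n$ has an $\mathbb R$-open neighborhood $U_n\supset F_n$ such that $(U_n)_{n\in\omega}$ is compact-finite. *)

theory Defs
  imports "HOL-Analysis.Analysis"
begin

definition rectifiable_space :: "'a topology \<Rightarrow> bool" where
  "rectifiable_space X \<longleftrightarrow>
     (\<exists>e\<in>topspace X. \<exists>h. homeomorphic_map (prod_topology X X) (prod_topology X X) h \<and>
        h ` {(x, x) |x. x \<in> topspace X} = topspace X \<times> {e} \<and>
        (\<forall>x\<in>topspace X. h ` ({x} \<times> topspace X) = {x} \<times> topspace X))"

(* The library's regular_space and completely_regular_space do not include T1. *)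

definition regular_t1_space :: "'a topology \<Rightarrow> bool" where
  "regular_t1_space X \<longleftrightarrow> regular_space X \<and> t1_space X"

definition tychonoff_space :: "'a topology \<Rightarrow> bool" where
  "tychonoff_space X \<longleftrightarrow> completely_regular_space X \<and> t1_space X"

definition network_in :: "'a topology \<Rightarrow> 'a set set \<Rightarrow> bool" where
  "network_in X \<N> \<longleftrightarrow> \<Union>\<N> \<subseteq> topspace X \<and>
     (\<forall>x U. openin X U \<and> x \<in> U \<longrightarrow> (\<exists>N\<in>\<N>. x \<in> N \<and> N \<subseteq> U))"

definition k_network_in :: "'a topology \<Rightarrow> 'a set set \<Rightarrow> bool" where
  "k_network_in X \<N> \<longleftrightarrow> \<Union>\<N> \<subseteq> topspace X \<and>
     (\<forall>U K. openin X U \<and> compactin X K \<and> K \<subseteq> U \<longrightarrow>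
        (\<exists>\<F>. finite \<F> \<and> \<F> \<subseteq> \<N> \<and> K \<subseteq> \<Union>\<F> \<and> \<Union>\<F> \<subseteq> U))"

definition cosmic_space :: "'a topology \<Rightarrow> bool" where
  "cosmic_space X \<longleftrightarrow> regular_t1_space X \<and> (\<exists>\<N>. countable \<N> \<and> network_in X \<N>)"

definition aleph_space :: "'a topology \<Rightarrow> bool" where
  "aleph_space X \<longleftrightarrow> regular_t1_space X \<and>
     (\<exists>\<C>. countable \<C> \<and> (\<forall>\<A>\<in>\<C>. locally_finite_in X \<A>) \<and> k_network_in X (\<Union>\<C>))"

definition k_real_space :: "'a topology \<Rightarrow> bool" where
  "k_real_space X \<longleftrightarrow>
     (\<forall>f. (\<forall>K. compactin X K \<longrightarrow> continuous_map (subtopology X K) euclideanreal f)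
          \<longrightarrow> continuous_map X euclideanreal f)"

definition k_omega_space :: "'a topology \<Rightarrow> bool" where
  "k_omega_space X \<longleftrightarrow>
     (\<exists>\<K>. countable \<K> \<and> (\<forall>K\<in>\<K>. compactin X K) \<and> \<Union>\<K> = topspace X \<and>
        (\<forall>F. F \<subseteq> topspace X \<longrightarrow>
           (closedin X F \<longleftrightarrow> (\<forall>K\<in>\<K>. closedin (subtopology X K) (F \<inter> K)))))"

(* Indexed families: a set that occurs at several indices is counted once for each index,
   unlike in the library's locally_finite_in, which concerns sets of sets. *)

definition locally_finite_seq :: "'a topology \<Rightarrow> (nat \<Rightarrow> 'a set) \<Rightarrow> bool" where
  "locally_finite_seq X F \<longleftrightarrow>
     (\<forall>x\<in>topspace X. \<exists>V. openin X V \<and> x \<in> V \<and> finite {n. F n \<inter> V \<noteq> {}})"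

definition compact_finite_seq :: "'a topology \<Rightarrow> (nat \<Rightarrow> 'a set) \<Rightarrow> bool" where
  "compact_finite_seq X F \<longleftrightarrow> (\<forall>K. compactin X K \<longrightarrow> finite {n. F n \<inter> K \<noteq> {}})"

definition real_openin :: "'a topology \<Rightarrow> 'a set \<Rightarrow> bool" where
  "real_openin X U \<longleftrightarrow> U \<subseteq> topspace X \<and>
     (\<forall>x\<in>U. \<exists>f. continuous_map X (top_of_set {0..1::real}) f \<and> f x = 1 \<and>
                f ` (topspace X - U) \<subseteq> {0})"

definition Fin_fan :: "'a topology \<Rightarrow> (nat \<Rightarrow> 'a set) \<Rightarrow> bool" where
  "Fin_fan X F \<longleftrightarrow> (\<forall>n. finite (F n) \<and> F n \<subseteq> topspace X) \<and>
     compact_finite_seq X F \<and> \<not> locally_finite_seq X F"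

definition strong_Fin_fan :: "'a topology \<Rightarrow> (nat \<Rightarrow> 'a set) \<Rightarrow> bool" where
  "strong_Fin_fan X F \<longleftrightarrow> Fin_fan X F \<and>
     (\<exists>U. (\<forall>n. real_openin X (U n) \<and> F n \<subseteq> U n) \<and> compact_finite_seq X U)"

(* Taking the index set and the summands inside the type of points of X loses no generality:
   each summand embeds in X, and the nonempty ones are indexed injectively by choosing a
   point in each. *)

definition sum_of_cosmic_k_omega_spaces :: "'a topology \<Rightarrow> bool" where
  "sum_of_cosmic_k_omega_spaces X \<longleftrightarrow>
     (\<exists>(I :: 'a set) (Y :: 'a \<Rightarrow> 'a topology).
        (\<forall>i\<in>I. cosmic_space (Y i) \<and> k_omega_space (Y i)) \<and>
        X homeomorphic_space sum_topology Y I)"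

end

theory Submission
  imports Defs
begin

text \<open>A Fin-fan in a Tychonoff \<open>\<aleph>\<close>-space is automatically strong, so compact-finite sequences of finite
  sets are locally finite in \<open>X\<close>. The rectification \<open>h\<close> provides a continuous division
  \<open>dv x y = snd (h (x, y))\<close> and a continuous multiplication \<open>mul x y = snd (inv h (x, y))\<close> with
  \<open>mul x (dv x y) = y\<close>. If there were both a metric fan (compact-finite sequences shrinking to \<open>e\<close>) and
  a sequential fan (a compact-finite family of sequences converging to \<open>e\<close>), then multiplying their
  points would produce a Fin-fan; so one of them is missing.

  Without sequential fans, the sequential coreflection of \<open>X\<close> is first countable, and the rectification
  turns a countable base at \<open>e\<close> into neighbourhoods satisfying Frink's metrization condition. A
  metrizable coreflection is completely regular, and a \<open>k\<^sub>R\<close>-space with completely regular coreflection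
  coincides with it. Without metric fans, every convergent sequence is trapped by finitely many
  compact members of a \<open>\<sigma>\<close>-locally finite \<open>k\<close>-network. Each of these members meets only countably many
  others, so chains of them split \<open>X\<close> into clopen cosmic \<open>k\<^sub>\<omega>\<close>-pieces.\<close>

section \<open>Metrization\<close>

text \<open>The obstacle is that sequences do not decide which sets are open in \<open>X\<close>:
  \<open>k_real_space\<close> only promises continuity of real functions that are continuous on
  compact sets. Openness in \<open>X\<close> is therefore reached through real functions. The bridge
  is that a closed sigma-locally finite \<open>k\<close>-network makes compactness of subsets
  equivalent to sequential compactness, so that sequentially continuous real functions are
  continuous. The substitute for first countability is \<open>V n y\<close>, the complement of the
  level-\<open>n\<close> network members that miss \<open>y\<close>. A convergent sequence of points
  of \<open>V (r k) (y k)\<close>, with \<open>r k\<close> tending to infinity, forces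
  \<open>y k\<close> to the same limit. This makes Fin-fans strong, keeps the products of the two
  fans compact-finite, and identifies the limits of diagonal sequences. Continuity of the operations
  is given for \<open>X\<close>, not for its coreflection; what survives is convergence of
  sequences. Frink's condition suits this, because its failure at a point supplies sequences to be
  refuted.\<close>

text \<open>The metric is a weighted supremum of the differences of the \<open>f k i\<close>. Near a
  point, \<open>disc\<close> leaves only one index \<open>i\<close> per level \<open>k\<close> that
  matters, and the weights make all but finitely many levels small; hence balls are neighbourhoods.
  Conversely \<open>sep\<close> supplies a level whose weight is the radius of a ball inside the
  given open set.\<close>

lemma metrizable_space_discrete_functions:
  fixes X :: "'a topology" and f :: "'k::countable \<Rightarrow> 'i \<Rightarrow> 'a \<Rightarrow> real"
  assumes t1: "t1_space X"
    and cont: "\<And>k i. continuous_map X euclideanreal (f k i)"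
    and range: "\<And>k i x. x \<in> topspace X \<Longrightarrow> 0 \<le> f k i x \<and> f k i x \<le> 1"
    and disc: "\<And>k x. x \<in> topspace X \<Longrightarrow>
          \<exists>V j. openin X V \<and> x \<in> V \<and> (\<forall>i y. i \<noteq> j \<and> y \<in> V \<longrightarrow> f k i y = 0)"
    and sep: "\<And>U x. openin X U \<Longrightarrow> x \<in> U \<Longrightarrow>
          \<exists>k i. f k i x = 1 \<and> (\<forall>y\<in>topspace X - U. f k i y = 0)"
  shows "metrizable_space X"
proof -
  define w :: "'k \<Rightarrow> real" where "w k = (1/2) ^ to_nat k" for k
  have w: "0 < w k" "w k \<le> 1" for k
    by (auto simp: w_def power_le_one)
  define g where "g = (\<lambda>x y (k,i). w k * \<bar>f k i x - f k i y\<bar>)"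
  \<comment> \<open>\<open>Metric_space\<close> demands nonnegativity and symmetry for all
    arguments, whereas the supremum is known to be bounded on \<open>topspace X\<close> only; hence
    the value 0 elsewhere.\<close>
  define d where "d x y = (if x \<in> topspace X \<and> y \<in> topspace X then SUP p. g x y p else 0)" for x y
  have g0: "0 \<le> g x y p" for x y p
    using w(1)[THEN less_imp_le] by (auto simp: g_def split: prod.split)
  have gw: "g x y (k,i) \<le> w k" if "x \<in> topspace X" "y \<in> topspace X" for x y k i
  proof -
    have "\<bar>f k i x - f k i y\<bar> \<le> 1"
      using range[OF that(1), of k i] range[OF that(2), of k i] by linarith
    then show ?thesis
      using w(1)[of k] by (simp add: g_def mult_left_le)
  qed
  have g1: "g x y p \<le> 1" if "x \<in> topspace X" "y \<in> topspace X" for x y p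
    using gw[OF that, of "fst p" "snd p"] w(2)[of "fst p"] by simp
  have bdd: "bdd_above (range (g x y))" if "x \<in> topspace X" "y \<in> topspace X" for x y
    using g1[OF that] by (auto intro!: bdd_aboveI)
  have g_le_d: "g x y p \<le> d x y" if "x \<in> topspace X" "y \<in> topspace X" for x y p
    using bdd[OF that] that by (simp add: d_def cSUP_upper)
  have d_le: "d x y \<le> r" if "x \<in> topspace X" "y \<in> topspace X" "\<And>p. g x y p \<le> r" for x y r
    using that by (simp add: d_def cSUP_least)
  have d0: "0 \<le> d x y" for x y
    using order_trans[OF g0 g_le_d] by (cases "x \<in> topspace X \<and> y \<in> topspace X") (auto simp: d_def)
  interpret d: Metric_space "topspace X" d
  proof
    fix x y z
    show "0 \<le> d x y" by (rule d0)
    have "g x y = g y x"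
      by (auto simp: g_def abs_minus_commute)
    then show "d x y = d y x" by (simp add: d_def)
    assume xy: "x \<in> topspace X" "y \<in> topspace X"
    show "d x y = 0 \<longleftrightarrow> x = y"
    proof
      show "x = y" if "d x y = 0"
      proof (rule ccontr)
        assume "x \<noteq> y"
        then obtain U where "openin X U" "x \<in> U" "y \<notin> U"
          using t1 xy unfolding t1_space_def by blast
        then obtain k i where "f k i x = 1" "f k i y = 0"
          using sep xy by fastforce
        then have "g x y (k,i) = w k" by (simp add: g_def)
        then show False
          using g_le_d[OF xy, of "(k,i)"] w(1)[of k] that by simp
      qed
      show "d x y = 0" if "x = y"
        using that by (simp add: d_def g_def case_prod_beta)
    qed
    assume z: "z \<in> topspace X"
    show "d x z \<le> d x y + d y z"
    proof (rule d_le[OF xy(1) z])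
      fix p
      have "g x z p \<le> g x y p + g y z p"
        using w(1)[THEN less_imp_le]
        by (auto simp: g_def split: prod.split simp flip: distrib_left intro!: mult_left_mono)
      also have "\<dots> \<le> d x y + d y z"
        using g_le_d xy z by (simp add: add_mono)
      finally show "g x z p \<le> d x y + d y z" .
    qed
  qed
  have "openin X U \<longleftrightarrow> openin d.mtopology U" for U
  proof
    assume U: "openin X U"
    have "\<exists>r>0. d.mball x r \<subseteq> U" if x: "x \<in> U" for x
    proof -
      have xX: "x \<in> topspace X" using U x openin_subset by blast
      obtain k i where ki: "f k i x = 1" "\<forall>y\<in>topspace X - U. f k i y = 0"
        using sep[OF U x] by blast
      have "y \<in> U" if "y \<in> d.mball x (w k)" for y
      proof (rule ccontr)
        assume "y \<notin> U"
        with that ki have "g x y (k,i) = w k" by (simp add: g_def)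
        then show False
          using that g_le_d[OF xX, of y "(k,i)"] by simp
      qed
      then show ?thesis using w(1) by blast
    qed
    then show "openin d.mtopology U"
      using openin_subset[OF U] by (simp add: d.openin_mtopology)
  next
    assume U: "openin d.mtopology U"
    show "openin X U"
    proof (subst openin_subopen, clarify)
      fix x assume x: "x \<in> U"
      then have xX: "x \<in> topspace X"
        using U by (auto simp: d.openin_mtopology)
      obtain r where r: "r > 0" "d.mball x r \<subseteq> U"
        using U x by (auto simp: d.openin_mtopology)
      obtain n where n: "(1/2::real) ^ n < r"
        using r(1) real_arch_pow_inv by fastforce
      \<comment> \<open>Only the finitely many levels in \<open>D\<close> need a neighbourhood; on
        every other level the weight is already at most \<open>(1/2)^n < r\<close>.\<close>
      define D where "D = {k::'k. to_nat k < n}"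
      have "inj_on (to_nat :: 'k \<Rightarrow> nat) D" "to_nat ` D \<subseteq> {..<n}"
        by (auto simp: D_def)
      then have finD: "finite D"
        using inj_on_finite by blast
      have "\<exists>V. openin X V \<and> x \<in> V \<and> (\<forall>y\<in>V. \<forall>i. \<bar>f k i x - f k i y\<bar> < r/2)" for k
      proof -
        obtain V j where V: "openin X V" "x \<in> V" "\<And>i y. i \<noteq> j \<and> y \<in> V \<Longrightarrow> f k i y = 0"
          using disc[OF xX, of k] by blast
        define W where "W = {y \<in> topspace X. f k j y \<in> {f k j x - r/2<..<f k j x + r/2}}"
        have "openin X W"
          unfolding W_def by (rule openin_continuous_map_preimage[OF cont]) simp
        moreover have "x \<in> W" using xX r(1) by (simp add: W_def)
        moreover have "\<bar>f k i x - f k i y\<bar> < r/2" if "y \<in> V \<inter> W" for y i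
        proof (cases "i = j")
          case True
          have "f k j y < f k j x + r/2" "f k j x - r/2 < f k j y"
            using that by (auto simp: W_def)
          then show ?thesis unfolding True by linarith
        next
          \<comment> \<open>\<open>x\<close> lies in \<open>V\<close> as well, so both values
            vanish.\<close>
          case False
          then show ?thesis using that V r(1) by simp
        qed
        ultimately show ?thesis using V by (intro exI[of _ "V \<inter> W"]) auto
      qed
      then obtain V where V: "\<And>k. openin X (V k)" "\<And>k. x \<in> V k"
        "\<And>k i y. y \<in> V k \<Longrightarrow> \<bar>f k i x - f k i y\<bar> < r/2"
        by metis
      define W where "W = topspace X \<inter> (\<Inter>k\<in>D. V k)"
      have "openin X W"
        unfolding W_def using finD V(1) by (intro openin_Int_Inter) auto
      moreover have "x \<in> W" using xX V by (simp add: W_def)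
      moreover have "W \<subseteq> U"
      proof
        fix y assume y: "y \<in> W"
        then have yX: "y \<in> topspace X" by (simp add: W_def)
        have "d x y \<le> max (r/2) ((1/2)^n)"
        proof (rule d_le[OF xX yX])
          fix p :: "'k \<times> 'i" obtain k i where p: "p = (k,i)" by fastforce
          show "g x y p \<le> max (r/2) ((1/2)^n)"
          proof (cases "k \<in> D")
            case True
            then have *: "\<bar>f k i x - f k i y\<bar> < r/2" using y V(3) by (auto simp: W_def)
            have "g x y p \<le> \<bar>f k i x - f k i y\<bar>"
              unfolding g_def p using w[of k] by (simp add: mult_left_le_one_le)
            with * show ?thesis by linarith
          next
            case False
            then have "w k \<le> (1/2)^n" unfolding w_def D_def by (simp add: power_decreasing)
            then show ?thesis using gw[OF xX yX, of k i] p by simp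
          qed
        qed
        with n r(1) have "d x y < r" by simp
        then show "y \<in> U" using r(2) xX yX by (auto simp: subset_iff)
      qed
      ultimately show "\<exists>T. openin X T \<and> x \<in> T \<and> T \<subseteq> U" by blast
    qed
  qed
  then have "X = d.mtopology" by (simp add: topology_eq)
  then show ?thesis using d.metrizable_space_mtopology by simp
qed

lemma regular_space_open_closure:
  assumes "regular_space X" "openin X U" "x \<in> U"
  obtains V where "openin X V" "x \<in> V" "X closure_of V \<subseteq> U"
proof -
  have "neighbourhood_base_of (closedin X) X"
    using assms(1) by (simp add: neighbourhood_base_of_closedin)
  then obtain V C where "openin X V" "closedin X C" "x \<in> V" "V \<subseteq> C" "C \<subseteq> U"
    using assms(2,3) unfolding neighbourhood_base_of by meson
  then show ?thesis using that closure_of_minimal by (metis subset_trans)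
qed

text \<open>Bing's criterion. Discreteness makes closure commute with unions inside a level, so
  \<open>S k U\<close> is an open set whose closure stays in \<open>U\<close>, and countably many of
  them fill \<open>U\<close>. This yields normality, hence Urysohn functions vanishing outside the
  sets \<open>B k i\<close>, to which the preceding metrization applies.\<close>

lemma metrizable_space_sigma_discrete_base:
  fixes X :: "'a topology" and B :: "'k::countable \<Rightarrow> 'i \<Rightarrow> 'a set"
  assumes t1: "t1_space X" and reg: "regular_space X"
    and opn: "\<And>k i. openin X (B k i)"
    and disc: "\<And>k x. x \<in> topspace X \<Longrightarrow>
          \<exists>V j. openin X V \<and> x \<in> V \<and> (\<forall>i. B k i \<inter> V \<noteq> {} \<longrightarrow> i = j)"
    and base: "\<And>U x. openin X U \<Longrightarrow> x \<in> U \<Longrightarrow> \<exists>k i. x \<in> B k i \<and> B k i \<subseteq> U"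
  shows "metrizable_space X"
proof -
  define S where "S k U = \<Union>{B k i |i. X closure_of (B k i) \<subseteq> U}" for k U
  have opS: "openin X (S k U)" for k U
    unfolding S_def using opn by auto
  have clS: "X closure_of (S k U) \<subseteq> U" for k U
  proof -
    have "locally_finite_in X {B k i |i. X closure_of (B k i) \<subseteq> U}"
      unfolding locally_finite_in_def
    proof (intro conjI ballI)
      show "\<Union> {B k i |i. X closure_of B k i \<subseteq> U} \<subseteq> topspace X"
        using opn openin_subset by blast
      fix x assume "x \<in> topspace X"
      from disc[OF this, of k]
      obtain V j where V: "openin X V" "x \<in> V" "\<forall>i. B k i \<inter> V \<noteq> {} \<longrightarrow> i = j"
        by blast
      then have "{A \<in> {B k i |i. X closure_of B k i \<subseteq> U}. A \<inter> V \<noteq> {}} \<subseteq> {B k j}"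
        by blast
      then have "finite {A \<in> {B k i |i. X closure_of B k i \<subseteq> U}. A \<inter> V \<noteq> {}}"
        by (rule finite_subset) simp
      then show "\<exists>V. openin X V \<and> x \<in> V \<and> finite {A \<in> {B k i |i. X closure_of B k i \<subseteq> U}. A \<inter> V \<noteq> {}}"
        using V by (intro exI[of _ V]) simp
    qed
    then show ?thesis
      unfolding S_def by (subst closure_of_locally_finite_Union) auto
  qed
  have covS: "\<exists>k. x \<in> S k U" if "openin X U" "x \<in> U" for x U
  proof -
    obtain V where V: "openin X V" "x \<in> V" "X closure_of V \<subseteq> U"
      using regular_space_open_closure[OF reg \<open>openin X U\<close> \<open>x \<in> U\<close>] by blast
    then obtain k i where ki: "x \<in> B k i" "B k i \<subseteq> V"
      using base by blast
    then have "X closure_of B k i \<subseteq> U"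
      using V(3) closure_of_mono[OF ki(2), of X] by blast
    then show ?thesis using ki unfolding S_def by blast
  qed
  have normal: "normal_space X"
    unfolding normal_space_def
  proof clarify
    fix P Q
    assume clo: "closedin X P" "closedin X Q" and disj: "disjnt P Q"
    define h where "h n = S (from_nat n :: 'k) (topspace X - Q)" for n
    define k where "k n = S (from_nat n :: 'k) (topspace X - P)" for n
    have opeh: "openin X (h n)" and opek: "openin X (k n)" for n
      by (auto simp: h_def k_def opS)
    have dish: "disjnt Q (X closure_of (h n))" and disk: "disjnt P (X closure_of (k n))" for n
      using clS[of "from_nat n" "topspace X - Q"] clS[of "from_nat n" "topspace X - P"]
      by (auto simp: h_def k_def disjnt_iff)
    have Ph: "P \<subseteq> \<Union>(range h)"
    proof
      fix x assume "x \<in> P"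
      then have "x \<in> topspace X - Q" "openin X (topspace X - Q)"
        using clo disj closedin_subset by (auto simp: disjnt_iff)
      then obtain j where "x \<in> S j (topspace X - Q)" using covS by blast
      then have "x \<in> h (to_nat j)" by (simp add: h_def)
      then show "x \<in> \<Union>(range h)" by blast
    qed
    have Qk: "Q \<subseteq> \<Union>(range k)"
    proof
      fix x assume "x \<in> Q"
      then have "x \<in> topspace X - P" "openin X (topspace X - P)"
        using clo disj closedin_subset by (auto simp: disjnt_iff)
      then obtain j where "x \<in> S j (topspace X - P)" using covS by blast
      then have "x \<in> k (to_nat j)" by (simp add: k_def)
      then show "x \<in> \<Union>(range k)" by blast
    qed
    \<comment> \<open>The strict bound here and the weak bound in \<open>V\<close> settle ties: a
      common point of the pieces \<open>h j\<close> and \<open>k i\<close> is excluded by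
      \<open>V\<close> when \<open>j \<le> i\<close> and by \<open>U\<close> when
      \<open>i < j\<close>.\<close>
    define U where "U \<equiv> \<Union>i. h i - (\<Union>j<i. X closure_of k j)"
    define V where "V \<equiv> \<Union>i. k i - (\<Union>j\<le>i. X closure_of h j)"
    show "\<exists>U V. openin X U \<and> openin X V \<and> P \<subseteq> U \<and> Q \<subseteq> V \<and> disjnt U V"
    proof (intro exI conjI)
      show "openin X U" "openin X V"
        unfolding U_def V_def
        by (force intro!: opek opeh closedin_Union closedin_closure_of)+
      show "P \<subseteq> U" "Q \<subseteq> V"
        using Ph Qk dish disk by (fastforce simp: U_def V_def disjnt_iff)+
      have "\<And>x i j. \<lbrakk>x \<in> k i; x \<in> h j; \<forall>j\<le>i. x \<notin> X closure_of h j\<rbrakk>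
                 \<Longrightarrow> \<exists>i<j. x \<in> X closure_of k i"
        by (metis in_closure_of linorder_not_less opek openin_subset subsetD)
      then show "disjnt U V"
        by (force simp: U_def V_def disjnt_iff)
    qed
  qed
  have "\<exists>f. continuous_map X (top_of_set {0..1::real}) f \<and>
          f ` (topspace X - B k i) \<subseteq> {0} \<and> f ` (X closure_of (S l (B k i))) \<subseteq> {1}"
    (is "\<exists>f. ?P k l i f") for k l i
  proof -
    have "disjnt (topspace X - B k i) (X closure_of (S l (B k i)))"
      using clS[of l "B k i"] by (auto simp: disjnt_iff)
    then obtain f where "continuous_map X (top_of_set {0..1::real}) f"
      "f ` (topspace X - B k i) \<subseteq> {0}" "f ` (X closure_of (S l (B k i))) \<subseteq> {1}"
      using Urysohn_lemma[OF normal, of "topspace X - B k i" "X closure_of (S l (B k i))" 0 1] opn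
      by (metis closedin_closure_of closedin_diff closedin_topspace zero_le_one)
    then show ?thesis by blast
  qed
  then have ex: "\<exists>f. ?P k l i f" for k l i .
  define \<phi> where "\<phi> k l i = (SOME f. ?P k l i f)" for k l i
  have "?P k l i (\<phi> k l i)" for k l i
    unfolding \<phi>_def by (rule someI_ex[OF ex])
  then have \<phi>: "\<And>k l i. continuous_map X (top_of_set {0..1::real}) (\<phi> k l i)"
    "\<And>k l i. \<phi> k l i ` (topspace X - B k i) \<subseteq> {0}"
    "\<And>k l i. \<phi> k l i ` (X closure_of (S l (B k i))) \<subseteq> {1}"
    by blast+
  \<comment> \<open>The second level \<open>l\<close> selects the part \<open>S l (B k i)\<close> on
    which the function is 1. Pairs of levels are still countable, and the functions vanish outside
    \<open>B k i\<close>, so discreteness is inherited.\<close>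
  define f where "f = (\<lambda>(k,l). \<phi> k l)"
  show ?thesis
  proof (rule metrizable_space_discrete_functions[of X f])
    show "continuous_map X euclideanreal (f k i)" for k i
      using \<phi>(1) by (simp add: f_def continuous_map_in_subtopology split: prod.split)
    show "0 \<le> f k i x \<and> f k i x \<le> 1" if "x \<in> topspace X" for k i x
      using \<phi>(1)[of "fst k" "snd k" i] that
      by (auto simp: f_def continuous_map_in_subtopology Pi_iff split: prod.splits)
    show "\<exists>V j. openin X V \<and> x \<in> V \<and> (\<forall>i y. i \<noteq> j \<and> y \<in> V \<longrightarrow> f k i y = 0)"
      if x: "x \<in> topspace X" for k x
    proof -
      obtain a b where k: "k = (a,b)" by fastforce
      obtain V j where V: "openin X V" "x \<in> V" "\<forall>i. B a i \<inter> V \<noteq> {} \<longrightarrow> i = j"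
        using disc[OF x, of a] by blast
      have "f k i y = 0" if "i \<noteq> j" "y \<in> V" for i y
      proof -
        have "y \<in> topspace X - B a i" using V that openin_subset[OF V(1)] by blast
        then show ?thesis using \<phi>(2)[of a b i] by (auto simp: f_def k)
      qed
      then show ?thesis using V by blast
    qed
    show "\<exists>k i. f k i x = 1 \<and> (\<forall>y\<in>topspace X - U. f k i y = 0)" if U: "openin X U" "x \<in> U" for U x
    proof -
      obtain k i where ki: "x \<in> B k i" "B k i \<subseteq> U" using base U by blast
      obtain l where l: "x \<in> S l (B k i)" using covS[OF opn ki(1)] by blast
      have "f (k,l) i x = 1"
      proof -
        have "x \<in> X closure_of S l (B k i)"
          using l closure_of_subset[OF openin_subset[OF opS[of l "B k i"]]] by blast
        then show ?thesis using \<phi>(3)[of k l i] by (auto simp: f_def)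
      qed
      moreover have "\<forall>y\<in>topspace X - U. f (k,l) i y = 0"
      proof
        fix y assume "y \<in> topspace X - U"
        then have "y \<in> topspace X - B k i" using ki by blast
        then show "f (k,l) i y = 0" using \<phi>(2)[of k l i] by (auto simp: f_def)
      qed
      ultimately show ?thesis by blast
    qed
  qed (rule t1)
qed

text \<open>The covers by the sets \<open>U j a\<close> are refined in the manner of Stone. Each
  point is assigned to the first \<open>a\<close> in a well-order with \<open>x\<close> in
  \<open>U j a\<close>; since the radii that work depend on the point, they are recorded in the
  index \<open>(j,n,k,m)\<close>. With these fixed, two assigned points that come close lie in each
  other's \<open>U j\<close>-sets, and minimality identifies their centres. The resulting base is
  sigma-discrete.\<close>

lemma metrizable_space_Frink:
  fixes X :: "'a topology" and U :: "nat \<Rightarrow> 'a \<Rightarrow> 'a set"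
  assumes t1: "t1_space X"
    and opn: "\<And>n x. x \<in> topspace X \<Longrightarrow> openin X (U n x) \<and> x \<in> U n x"
    and base: "\<And>W x. openin X W \<Longrightarrow> x \<in> W \<Longrightarrow> \<exists>n. U n x \<subseteq> W"
    and frink: "\<And>n x. x \<in> topspace X \<Longrightarrow>
          \<exists>k. \<forall>y\<in>topspace X. U k x \<inter> U k y \<noteq> {} \<longrightarrow> U k y \<subseteq> U n x"
  shows "metrizable_space X"
proof -
  define F where "F x n k \<longleftrightarrow> (\<forall>y\<in>topspace X. U k x \<inter> U k y \<noteq> {} \<longrightarrow> U k y \<subseteq> U n x)" for x n k
  have F: "U k y \<subseteq> U n x" if "F x n k" "y \<in> topspace X" "z \<in> U k x" "z \<in> U k y" for x n k y z
    using that unfolding F_def by blast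
  have reg: "regular_space X"
    unfolding neighbourhood_base_of_closedin[symmetric] neighbourhood_base_of
  proof (intro allI impI, elim conjE)
    fix W x assume W: "openin X W" "x \<in> W"
    then have x: "x \<in> topspace X" using openin_subset by blast
    obtain n where n: "U n x \<subseteq> W" using base W by blast
    obtain k where k: "F x n k" using frink[OF x] unfolding F_def by blast
    have "X closure_of (U k x) \<subseteq> U n x"
    proof
      fix z assume z: "z \<in> X closure_of (U k x)"
      then have zX: "z \<in> topspace X" by (simp add: in_closure_of)
      with opn[OF zX, of k] z obtain y where "y \<in> U k x" "y \<in> U k z"
        by (auto simp: in_closure_of)
      then have "U k z \<subseteq> U n x" using F[OF k zX] by blast
      then show "z \<in> U n x" using opn[OF zX, of k] by blast
    qed
    then show "\<exists>Ua V. openin X Ua \<and> closedin X V \<and> x \<in> Ua \<and> Ua \<subseteq> V \<and> V \<subseteq> W"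
      using opn[OF x, of k] n
      by (intro exI[of _ "U k x"] exI[of _ "X closure_of (U k x)"])
         (auto intro!: closure_of_subset dest: openin_subset)
  qed
  obtain R :: "'a rel" where "well_order_on UNIV R"
    using well_order_on by blast
  then have wo: "wf (R - Id)" and tot: "\<And>a b. a = b \<or> (a,b) \<in> R - Id \<or> (b,a) \<in> R - Id"
    by (auto simp: well_order_on_def linear_order_on_def total_on_def)
  define first where "first j x a \<longleftrightarrow> a \<in> topspace X \<and> x \<in> U j a \<and>
      (\<forall>b. (b,a) \<in> R - Id \<longrightarrow> \<not> (b \<in> topspace X \<and> x \<in> U j b))" for j x a
  have first_ex: "\<exists>a. first j x a" if x: "x \<in> topspace X" for j x
  proof -
    have "x \<in> {a. a \<in> topspace X \<and> x \<in> U j a}" using opn[OF x] x by simp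
    then obtain a where "a \<in> {a. a \<in> topspace X \<and> x \<in> U j a}"
      "\<And>b. (b,a) \<in> R - Id \<Longrightarrow> b \<notin> {a. a \<in> topspace X \<and> x \<in> U j a}"
      using wfE_min[OF wo, of x "{a. a \<in> topspace X \<and> x \<in> U j a}"]
      by (metis wo wfE_min)
    then have "first j x a" unfolding first_def by simp
    then show ?thesis ..
  qed
  \<comment> \<open>Two applications of the condition will be needed: \<open>m\<close> brings a
    nearby point \<open>z\<close> into \<open>U k x\<close>, then \<open>k\<close> brings another
    assigned point \<open>y\<close> into \<open>U n x\<close>, which lies in
    \<open>U j a\<close>.\<close>
  define E where "E = (\<lambda>(j,n,k) a. {x \<in> topspace X. first j x a \<and> U n x \<subseteq> U j a \<and> F x n k})"
  define B where "B = (\<lambda>(j,n,k,m) a. \<Union>{U m x |x. x \<in> E (j,n,k) a \<and> F x k m})"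
  show ?thesis
  proof (rule metrizable_space_sigma_discrete_base[OF t1 reg, of B])
    show "openin X (B p a)" for p a
      unfolding B_def E_def using opn by (auto split: prod.split)
    show "\<exists>V b. openin X V \<and> z \<in> V \<and> (\<forall>a. B p a \<inter> V \<noteq> {} \<longrightarrow> a = b)"
      if z: "z \<in> topspace X" for p z
    proof -
      obtain j n k m where p: "p = (j,n,k,m)" by (metis prod.collapse)
      have eq: "a = b" if ab: "B p a \<inter> U m z \<noteq> {}" "B p b \<inter> U m z \<noteq> {}" for a b
      proof -
        obtain x u where x: "x \<in> topspace X" "first j x a" "U n x \<subseteq> U j a" "F x n k" "F x k m"
          "u \<in> U m x" "u \<in> U m z"
          using ab(1) by (auto simp: B_def E_def p)
        obtain y v where y: "y \<in> topspace X" "first j y b" "U n y \<subseteq> U j b" "F y n k" "F y k m"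
          "v \<in> U m y" "v \<in> U m z"
          using ab(2) by (auto simp: B_def E_def p)
        have "z \<in> U k x" "z \<in> U k y"
          using F[of x k m z u] F[of y k m z v] x y z opn[OF z, of m] by blast+
        then have "y \<in> U n x" "x \<in> U n y"
          using F[of x n k y z] F[of y n k x z] x y opn[of _ k] by blast+
        then have "y \<in> U j a" "x \<in> U j b" using x y by blast+
        then show "a = b" using tot[of a b] x(2) y(2) unfolding first_def by blast
      qed
      show ?thesis
      proof (cases "\<exists>b. B p b \<inter> U m z \<noteq> {}")
        case True
        then obtain b where "B p b \<inter> U m z \<noteq> {}" by blast
        then show ?thesis using opn[OF z, of m] eq by blast
      next
        case False
        then show ?thesis using opn[OF z, of m] by blast
      qed
    qed
    show "\<exists>p a. x \<in> B p a \<and> B p a \<subseteq> W" if W: "openin X W" "x \<in> W" for W x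
    proof -
      have x: "x \<in> topspace X" using W openin_subset by blast
      obtain n0 where n0: "U n0 x \<subseteq> W" using base W by blast
      \<comment> \<open>With this \<open>j\<close>, every set \<open>U j a\<close> that contains
        \<open>x\<close> lies in \<open>U n0 x\<close>, whichever \<open>a\<close> comes
        first.\<close>
      obtain j where j: "F x n0 j" using frink[OF x] unfolding F_def by blast
      obtain a where a: "first j x a" using first_ex[OF x] by blast
      then have aX: "a \<in> topspace X" "x \<in> U j a" by (auto simp: first_def)
      obtain n where n: "U n x \<subseteq> U j a" using base[OF conjunct1[OF opn[OF aX(1)]] aX(2)] by blast
      obtain k where k: "F x n k" using frink[OF x] unfolding F_def by blast
      obtain m where m: "F x k m" using frink[OF x] unfolding F_def by blast
      have "x \<in> E (j,n,k) a"
        unfolding E_def prod.case mem_Collect_eq using x a n k by (intro conjI)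
      then have "x \<in> B (j,n,k,m) a"
        using m opn[OF x, of m] unfolding B_def prod.case by blast
      moreover have "B (j,n,k,m) a \<subseteq> U j a"
      proof
        fix u assume "u \<in> B (j,n,k,m) a"
        then obtain y where y: "y \<in> topspace X" "U n y \<subseteq> U j a" "F y n k" "F y k m" "u \<in> U m y"
          by (auto simp: B_def E_def)
        then have "U m y \<subseteq> U k y" "U k y \<subseteq> U n y"
          using F[of y k m y y] F[of y n k y y] opn[OF y(1)] by blast+
        with y show "u \<in> U j a" by blast
      qed
      moreover have "U j a \<subseteq> U n0 x"
        using F[OF j aX(1) _ aX(2)] opn[OF x, of j] by blast
      ultimately show ?thesis using n0 by blast
    qed
  qed
qed

section \<open>Compactness in spaces with a closed \<open>\<sigma>\<close>-locally finite \<open>k\<close>-network\<close>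

lemma infinite_sets_strict_mono_selection:
  fixes A :: "nat \<Rightarrow> nat set"
  assumes "\<And>i. infinite (A i)"
  shows "\<exists>r. strict_mono r \<and> (\<forall>i. r i \<in> A i)"
proof -
  have "\<exists>r. \<forall>n. r n \<in> A n \<and> r n < r (Suc n)"
  proof (rule dependent_nat_choice)
    show "\<exists>x. x \<in> A 0" using assms[of 0] infinite_imp_nonempty by blast
    show "\<exists>y. y \<in> A (Suc n) \<and> x < y" for x n
      using assms[of "Suc n"] unfolding infinite_nat_iff_unbounded by blast
  qed
  then show ?thesis by (auto simp: strict_mono_Suc_iff)
qed

lemma compactin_cluster_point:
  assumes K: "compactin X K" and I: "infinite I" and z: "\<And>n. n \<in> I \<Longrightarrow> z n \<in> K"
  shows "\<exists>l\<in>K. \<forall>U. openin X U \<and> l \<in> U \<longrightarrow> infinite {n\<in>I. z n \<in> U}"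
proof (rule ccontr)
  assume "\<not> ?thesis"
  then have "\<forall>l\<in>K. \<exists>U. openin X U \<and> l \<in> U \<and> finite {n\<in>I. z n \<in> U}" by blast
  then obtain U where U: "\<And>l. l \<in> K \<Longrightarrow> openin X (U l) \<and> l \<in> U l \<and> finite {n\<in>I. z n \<in> U l}"
    by metis
  then have "(\<forall>A\<in>U ` K. openin X A) \<and> K \<subseteq> \<Union>(U ` K)" by blast
  then obtain \<F> where F: "finite \<F>" "\<F> \<subseteq> U ` K" "K \<subseteq> \<Union>\<F>"
    using K unfolding compactin_def by meson
  have "I \<subseteq> (\<Union>A\<in>\<F>. {n\<in>I. z n \<in> A})" using z F(3) by blast
  moreover have "finite (\<Union>A\<in>\<F>. {n\<in>I. z n \<in> A})"
    using F U by blast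
  ultimately show False using I finite_subset by blast
qed

text \<open>A tail is taken because \<open>limitin\<close> leaves finitely many terms unconstrained;
  they may even lie outside the space.\<close>

lemma limitin_tail_compact:
  assumes lim: "limitin X \<sigma> l sequentially" and U: "openin X U" "l \<in> U"
  shows "\<exists>m. (\<forall>k\<ge>m. \<sigma> k \<in> U) \<and> compactin X (insert l (\<sigma> ` {m..}))"
proof -
  obtain m where m: "\<forall>k\<ge>m. \<sigma> k \<in> U"
    using lim U unfolding limitin_sequentially by blast
  then have "\<sigma> ` {m..} \<subseteq> topspace X" using openin_subset[OF U(1)] by auto
  then show ?thesis using m compactin_sequence_with_limit[OF lim, of "\<sigma> ` {m..}"] by blast
qed

lemma countable_UN_Collect:
  assumes "\<And>i::nat. finite {A \<in> N i. P A}"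
  shows "countable {A \<in> (\<Union>i. N i). P A}"
proof -
  have "{A \<in> (\<Union>i. N i). P A} = (\<Union>i. {A \<in> N i. P A})" by blast
  moreover have "countable (\<Union>i. {A \<in> N i. P A})"
    by (intro countable_UN countableI_type countable_finite assms)
  ultimately show ?thesis by (simp only:)
qed

text \<open>A normal form for the \<open>k\<close>-network of an aleph-space. Increasing levels let
  a single index serve a finite subfamily, closed members make the sets \<open>V n y\<close> open,
  and stability under intersections lets families that trap a sequence be refined.\<close>

locale k_network_space =
  fixes X :: "'a topology" and N :: "nat \<Rightarrow> 'a set set"
  assumes reg: "regular_space X" and t1: "t1_space X"
    and lf: "\<And>i. locally_finite_in X (N i)"
    and clo: "\<And>i A. A \<in> N i \<Longrightarrow> closedin X A"
    and mono: "\<And>i j. i \<le> j \<Longrightarrow> N i \<subseteq> N j"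
    and int: "\<And>i A B. A \<in> N i \<Longrightarrow> B \<in> N i \<Longrightarrow> A \<inter> B \<in> N i"
    and knet: "\<And>U K. openin X U \<Longrightarrow> compactin X K \<Longrightarrow> K \<subseteq> U \<Longrightarrow>
                 \<exists>i F. finite F \<and> F \<subseteq> N i \<and> K \<subseteq> \<Union>F \<and> \<Union>F \<subseteq> U"
begin

lemma Hausdorff: "Hausdorff_space X"
  using reg t1 regular_t1_imp_Hausdorff_space by blast

lemma limit_unique: "limitin X \<sigma> a sequentially \<Longrightarrow> limitin X \<sigma> b sequentially \<Longrightarrow> a = b"
  using limitin_Hausdorff_unique[OF _ _ _ Hausdorff] by fastforce

lemma point_finite: "x \<in> topspace X \<Longrightarrow> finite {A \<in> N i. x \<in> A}"
proof -
  assume "x \<in> topspace X"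
  then obtain V where "x \<in> V" "finite {A \<in> N i. A \<inter> V \<noteq> {}}"
    using lf[of i] unfolding locally_finite_in_def by blast
  then show ?thesis by (auto elim!: rev_finite_subset)
qed

lemma point_countable:
  assumes "x \<in> topspace X" shows "countable {A \<in> (\<Union>i. N i). x \<in> A}"
by (rule countable_UN_Collect) (rule point_finite[OF assms])

lemma compact_finite:
  assumes "compactin X K" shows "finite {A \<in> N i. A \<inter> K \<noteq> {}}"
proof -
  have "\<forall>x\<in>topspace X. \<exists>V. openin X V \<and> x \<in> V \<and> finite {A \<in> N i. A \<inter> V \<noteq> {}}"
    using lf[of i] unfolding locally_finite_in_def by blast
  then obtain V where V: "\<And>x. x \<in> topspace X \<Longrightarrow> openin X (V x) \<and> x \<in> V x \<and> finite {A \<in> N i. A \<inter> V x \<noteq> {}}"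
    by metis
  have KX: "K \<subseteq> topspace X" using assms compactin_subset_topspace by blast
  then have "(\<forall>A\<in>V ` K. openin X A) \<and> K \<subseteq> \<Union>(V ` K)" using V by blast
  then obtain \<F> where F: "finite \<F>" "\<F> \<subseteq> V ` K" "K \<subseteq> \<Union>\<F>"
    using assms unfolding compactin_def by meson
  have "{A \<in> N i. A \<inter> K \<noteq> {}} \<subseteq> (\<Union>W\<in>\<F>. {A \<in> N i. A \<inter> W \<noteq> {}})"
    using F(3) by blast
  moreover have "finite (\<Union>W\<in>\<F>. {A \<in> N i. A \<inter> W \<noteq> {}})"
  proof (rule finite_UN_I[OF F(1)])
    fix W assume "W \<in> \<F>"
    then obtain x where "x \<in> K" "W = V x" using F(2) by blast
    then show "finite {A \<in> N i. A \<inter> W \<noteq> {}}" using V KX by blast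
  qed
  ultimately show ?thesis by (rule finite_subset)
qed

lemma compact_countable:
  assumes "compactin X K" shows "countable {A \<in> (\<Union>i. N i). A \<inter> K \<noteq> {}}"
by (rule countable_UN_Collect) (rule compact_finite[OF assms])

text \<open>Shaped so that a level-\<open>n\<close> member containing any point of
  \<open>V n y\<close> must contain \<open>y\<close> itself (\<open>V_mem\<close>).\<close>

definition V :: "nat \<Rightarrow> 'a \<Rightarrow> 'a set" where
  "V n y = topspace X - \<Union>{A \<in> N n. y \<notin> A}"

lemma openin_V: "openin X (V n y)"
proof -
  have "closedin X (\<Union>{A \<in> N n. y \<notin> A})"
    by (rule closedin_locally_finite_Union) (auto simp: clo intro: locally_finite_in_subset[OF lf])
  then show ?thesis unfolding V_def by blast
qed

lemma V_self: "y \<in> topspace X \<Longrightarrow> y \<in> V n y"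
  by (auto simp: V_def)

lemma V_mem: "z \<in> V n y \<Longrightarrow> A \<in> N n \<Longrightarrow> z \<in> A \<Longrightarrow> y \<in> A"
  by (auto simp: V_def)

text \<open>A convergent sequence drags along any sequence of points whose network neighbourhoods
  it visits; this is what makes the neighbourhoods \<open>V n (y n)\<close> of a compact-finite family of points
  compact-finite again.\<close>

lemma V_limit:
  assumes lim: "limitin X z l sequentially" and r: "filterlim r at_top sequentially"
    and z: "\<And>k. z k \<in> V (r k) (y k)"
  shows "limitin X y l sequentially"
  unfolding limitin_sequentially
proof (intro conjI allI impI)
  show "l \<in> topspace X" using limitin_topspace[OF lim] .
  fix U assume U: "openin X U \<and> l \<in> U"
  then obtain m where m: "\<forall>k\<ge>m. z k \<in> U" "compactin X (insert l (z ` {m..}))"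
    using limitin_tail_compact[OF lim, of U] by blast
  then have "insert l (z ` {m..}) \<subseteq> U" using U by auto
  then obtain i F where F: "F \<subseteq> N i" "insert l (z ` {m..}) \<subseteq> \<Union>F" "\<Union>F \<subseteq> U"
    using knet[of U "insert l (z ` {m..})"] m(2) U by blast
  have "eventually (\<lambda>k. i \<le> r k) sequentially"
    using r by (simp add: filterlim_at_top)
  then obtain m' where m': "\<forall>k\<ge>m'. i \<le> r k" by (auto simp: eventually_sequentially)
  have "y k \<in> U" if "k \<ge> max m m'" for k
  proof -
    have "z k \<in> \<Union>F" using F(2) that by auto
    then obtain A where A: "A \<in> F" "z k \<in> A" by blast
    then have "A \<in> N (r k)" using F(1) mono[of i "r k"] m' that by auto
    then have "y k \<in> A" using V_mem[OF z] A by blast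
    then show ?thesis using A F(3) by blast
  qed
  then show "\<exists>m. \<forall>k\<ge>m. y k \<in> U" by blast
qed

lemma V_limit_const:
  assumes "limitin X z l sequentially" "filterlim r at_top sequentially"
    "\<And>k. z k \<in> V (r k) y" "y \<in> topspace X"
  shows "l = y"
proof -
  have "limitin X (\<lambda>_. y) l sequentially"
    by (rule V_limit[OF assms(1,2)]) (rule assms(3))
  moreover have "limitin X (\<lambda>_::nat. y) y sequentially" using assms(4) by simp
  ultimately show ?thesis by (rule limit_unique)
qed

text \<open>A cluster point \<open>l\<close> is the only point lying in \<open>V i l\<close> for all
  \<open>i\<close>. A subsequence is chosen in shrinking neighbourhoods with closures in these sets;
  if it failed to converge, compactness would give a second cluster point, which lies in all of them
  and so equals \<open>l\<close>.\<close>

lemma compactin_imp_seq: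
  fixes z :: "nat \<Rightarrow> 'a"
  assumes K: "compactin X K" and z: "\<And>n. z n \<in> K"
  shows "\<exists>l\<in>K. \<exists>r. strict_mono r \<and> limitin X (z \<circ> r) l sequentially"
proof -
  obtain l where l: "l \<in> K" "\<And>U. openin X U \<Longrightarrow> l \<in> U \<Longrightarrow> infinite {n. z n \<in> U}"
    using compactin_cluster_point[OF K infinite_UNIV_nat, of z] z by auto
  have lX: "l \<in> topspace X" using K l(1) compactin_subset_topspace by blast
  have "\<exists>Q. openin X Q \<and> l \<in> Q \<and> X closure_of Q \<subseteq> V i l" for i
    using regular_space_open_closure[OF reg openin_V V_self[OF lX]] by metis
  then obtain Q where Q: "\<And>i. openin X (Q i)" "\<And>i. l \<in> Q i" "\<And>i. X closure_of (Q i) \<subseteq> V i l"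
    by metis
  define P where "P i = (\<Inter>j\<le>i. Q j)" for i
  have "openin X (P i)" "l \<in> P i" for i
    unfolding P_def using Q by (auto intro!: openin_Inter)
  then have "infinite {n. z n \<in> P i}" for i using l(2) by blast
  then obtain r where r: "strict_mono r" "\<And>i. z (r i) \<in> P i"
    using infinite_sets_strict_mono_selection[of "\<lambda>i. {n. z n \<in> P i}"] by auto
  have "limitin X (z \<circ> r) l sequentially"
    unfolding limitin_sequentially
  proof (intro conjI allI impI)
    fix U assume U: "openin X U \<and> l \<in> U"
    show "\<exists>m. \<forall>n\<ge>m. (z \<circ> r) n \<in> U"
    proof (rule ccontr)
      assume *: "\<not> (\<exists>m. \<forall>n\<ge>m. (z \<circ> r) n \<in> U)"
      then have inf: "infinite {n. z (r n) \<notin> U}"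
        unfolding infinite_nat_iff_unbounded_le by auto
      have "compactin X (K - U)"
        using K U compactin_imp_closedin[OF Hausdorff K]
        by (intro closed_compactin[OF K]) (auto intro: closedin_diff)
      then obtain l' where l': "l' \<in> K - U"
        "\<And>W. openin X W \<Longrightarrow> l' \<in> W \<Longrightarrow> infinite {n \<in> {n. z (r n) \<notin> U}. z (r n) \<in> W}"
        using compactin_cluster_point[OF _ inf, of X "K - U" "\<lambda>n. z (r n)"] z by auto
      have l'X: "l' \<in> topspace X" using K l'(1) compactin_subset_topspace by blast
      have "l' \<in> X closure_of (Q i)" for i
        unfolding in_closure_of
      proof (intro conjI allI impI l'X)
        fix T assume T: "l' \<in> T \<and> openin X T"
        then have "infinite {n \<in> {n. z (r n) \<notin> U}. z (r n) \<in> T}" using l'(2) by blast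
        then obtain n where "n \<ge> i" "z (r n) \<in> T"
          unfolding infinite_nat_iff_unbounded_le by blast
        moreover have "z (r n) \<in> Q i" using r(2)[of n] \<open>n \<ge> i\<close> by (auto simp: P_def)
        ultimately show "\<exists>y. y \<in> Q i \<and> y \<in> T" by blast
      qed
      then have V: "l' \<in> V i l" for i using Q(3) by blast
      have "l = l'"
        using V_limit_const[of "\<lambda>_. l'" l' "\<lambda>n. n" l] V lX l'X by (auto simp: filterlim_ident)
      then show False using l'(1) U by blast
    qed
  qed (rule lX)
  then show ?thesis using l r by blast
qed

lemma compactin_imp_seq_infinite:
  fixes z :: "nat \<Rightarrow> 'a"
  assumes K: "compactin X K" and z: "infinite {n. z n \<in> K}"
  shows "\<exists>l\<in>K. \<exists>r. strict_mono r \<and> (\<forall>n. z (r n) \<in> K) \<and> limitin X (z \<circ> r) l sequentially"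
proof -
  obtain s :: "nat \<Rightarrow> nat" where s: "strict_mono s" "\<And>n. z (s n) \<in> K"
    using infinite_sets_strict_mono_selection[of "\<lambda>_. {n. z n \<in> K}", OF z] by auto
  obtain l r where r: "l \<in> K" "strict_mono r" "limitin X (z \<circ> s \<circ> r) l sequentially"
    using compactin_imp_seq[OF K, of "z \<circ> s"] s by auto
  then show ?thesis
    using s by (intro bexI[of _ l] exI[of _ "s \<circ> r"]) (auto simp: o_assoc intro: strict_mono_o)
qed

text \<open>A level meets \<open>C\<close> in finitely many members: otherwise points taken from
  distinct members would have a subsequence converging to a point where the level is locally finite.
  So countably many members meet \<open>C\<close>, an open cover has a countable subcover, and a
  sequence escaping its finite parts would have no convergent subsequence.\<close>

lemma seq_imp_compactin:
  assumes C: "C \<subseteq> topspace X"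
    and seq: "\<And>z :: nat \<Rightarrow> 'a. (\<And>n. z n \<in> C) \<Longrightarrow> \<exists>l\<in>C. \<exists>r. strict_mono r \<and> limitin X (z \<circ> r) l sequentially"
  shows "compactin X C"
proof -
  have fin: "finite {A \<in> N i. A \<inter> C \<noteq> {}}" for i
  proof (rule ccontr)
    assume inf: "infinite {A \<in> N i. A \<inter> C \<noteq> {}}"
    then obtain A :: "nat \<Rightarrow> 'a set" where A: "inj A" "range A \<subseteq> {A \<in> N i. A \<inter> C \<noteq> {}}"
      using infinite_countable_subset by blast
    then have "\<forall>n. \<exists>x. x \<in> A n \<inter> C" by blast
    then obtain z where z: "\<And>n. z n \<in> A n \<inter> C" by metis
    then obtain l r where lr: "l \<in> C" "strict_mono r" "limitin X (z \<circ> r) l sequentially"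
      using seq[of z] by blast
    then obtain W where W: "openin X W" "l \<in> W" "finite {A \<in> N i. A \<inter> W \<noteq> {}}"
      using lf[of i] C unfolding locally_finite_in_def by blast
    then obtain m where m: "\<forall>n\<ge>m. z (r n) \<in> W"
      using lr(3) unfolding limitin_sequentially by auto
    have "A (r n) \<in> {A \<in> N i. A \<inter> W \<noteq> {}}" if "n \<ge> m" for n
      using A(2) z[of "r n"] m that by blast
    then have "finite ((\<lambda>n. A (r n)) ` {m..})"
      by (intro finite_subset[OF _ W(3)]) auto
    moreover have "inj_on (\<lambda>n. A (r n)) {m..}"
      by (auto simp: inj_on_def strict_mono_eq[OF lr(2)] dest!: injD[OF A(1)])
    ultimately show False using finite_imageD infinite_Ici by blast
  qed
  have cnt: "countable {A \<in> (\<Union>i. N i). A \<inter> C \<noteq> {}}"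
    by (rule countable_UN_Collect) (rule fin)
  show ?thesis
    unfolding compactin_def
  proof (intro conjI allI impI C)
    fix \<U> assume U: "(\<forall>U\<in>\<U>. openin X U) \<and> C \<subseteq> \<Union>\<U>"
    define G where "G = {A \<in> {A \<in> (\<Union>i. N i). A \<inter> C \<noteq> {}}. \<exists>U\<in>\<U>. A \<subseteq> U}"
    have cG: "countable G" unfolding G_def using cnt by (rule countable_subset[rotated]) blast
    have "\<forall>A\<in>G. \<exists>U. U \<in> \<U> \<and> A \<subseteq> U" by (auto simp: G_def)
    then obtain h where h: "\<And>A. A \<in> G \<Longrightarrow> h A \<in> \<U> \<and> A \<subseteq> h A" by metis
    have cov: "\<exists>A\<in>G. x \<in> A" if x: "x \<in> C" for x
    proof -
      obtain U where U': "U \<in> \<U>" "x \<in> U" using U x by blast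
      have xU: "openin X U" "{x} \<subseteq> U" "compactin X {x}"
        using conjunct1[OF U] U' subsetD[OF C x] by simp_all
      obtain i F where F: "F \<subseteq> N i" "{x} \<subseteq> \<Union>F" "\<Union>F \<subseteq> U"
        using knet[OF xU(1,3,2)] by (elim exE conjE)
      then have "x \<in> \<Union>F" by simp
      then obtain A where "A \<in> F" "x \<in> A" by (rule UnionE)
      then have "A \<in> N i" "A \<subseteq> U" using F(1,3) by auto
      then have "A \<in> G" using x U'(1) \<open>x \<in> A\<close> unfolding G_def by auto
      then show ?thesis using \<open>x \<in> A\<close> ..
    qed
    show "\<exists>\<F>. finite \<F> \<and> \<F> \<subseteq> \<U> \<and> C \<subseteq> \<Union>\<F>"
    proof (cases "C = {}")
      case True
      then show ?thesis by (intro exI[of _ "{}"]) simp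
    next
      case False
      then have G: "G \<noteq> {}" using cov by blast
      define W where "W n = h (from_nat_into G n)" for n
      have W: "W n \<in> \<U>" for n using h from_nat_into[OF G] by (simp add: W_def)
      show ?thesis
      proof (rule ccontr)
        assume no: "\<not> (\<exists>\<F>. finite \<F> \<and> \<F> \<subseteq> \<U> \<and> C \<subseteq> \<Union>\<F>)"
        have "\<exists>x. x \<in> C - \<Union>(W ` {..n})" for n
        proof -
          have "finite (W ` {..n})" "W ` {..n} \<subseteq> \<U>" using W by auto
          then have "\<not> C \<subseteq> \<Union>(W ` {..n})" using no by meson
          then show ?thesis by blast
        qed
        then obtain z where z: "\<And>n. z n \<in> C - \<Union>(W ` {..n})" by metis
        then obtain l r where lr: "l \<in> C" "strict_mono r" "limitin X (z \<circ> r) l sequentially"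
          using seq[of z] by blast
        obtain A where A: "A \<in> G" "l \<in> A" using cov lr(1) by blast
        then obtain j where j: "from_nat_into G j = A" using from_nat_into_surj[OF cG] by blast
        have "openin X (W j)" "l \<in> W j" using W U h A by (auto simp: W_def j)
        then obtain m where m: "\<forall>n\<ge>m. z (r n) \<in> W j"
          using lr(3) unfolding limitin_sequentially by auto
        have "r (max m j) \<ge> j" using lr(2) by (meson max.cobounded2 order_trans strict_mono_imp_increasing)
        then have "z (r (max m j)) \<notin> W j" using z[of "r (max m j)"] by auto
        then show False using m by simp
      qed
    qed
  qed
qed

end

section \<open>Fans in rectifiable spaces\<close>

lemma locally_finite_in_Un:
  assumes "locally_finite_in X \<A>" "locally_finite_in X \<B>"
  shows "locally_finite_in X (\<A> \<union> \<B>)"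
  unfolding locally_finite_in_def
proof (intro conjI ballI)
  show "\<Union>(\<A> \<union> \<B>) \<subseteq> topspace X"
    using assms unfolding locally_finite_in_def by blast
  fix x assume x: "x \<in> topspace X"
  obtain V where V: "openin X V" "x \<in> V" "finite {U \<in> \<A>. U \<inter> V \<noteq> {}}"
    using assms(1) x unfolding locally_finite_in_def by blast
  obtain W where W: "openin X W" "x \<in> W" "finite {U \<in> \<B>. U \<inter> W \<noteq> {}}"
    using assms(2) x unfolding locally_finite_in_def by blast
  have "{U \<in> \<A> \<union> \<B>. U \<inter> (V \<inter> W) \<noteq> {}} \<subseteq> {U \<in> \<A>. U \<inter> V \<noteq> {}} \<union> {U \<in> \<B>. U \<inter> W \<noteq> {}}"
    by blast
  then have "finite {U \<in> \<A> \<union> \<B>. U \<inter> (V \<inter> W) \<noteq> {}}"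
    using V(3) W(3) by (meson finite_UnI finite_subset)
  then show "\<exists>V. openin X V \<and> x \<in> V \<and> finite {U \<in> \<A> \<union> \<B>. U \<inter> V \<noteq> {}}"
    using V W by (intro exI[of _ "V \<inter> W"]) auto
qed

lemma locally_finite_in_Inters:
  assumes "locally_finite_in X \<A>"
  shows "locally_finite_in X {\<Inter>F |F. F \<noteq> {} \<and> F \<subseteq> \<A>}"
  unfolding locally_finite_in_def
proof (intro conjI ballI)
  show "\<Union>{\<Inter>F |F. F \<noteq> {} \<and> F \<subseteq> \<A>} \<subseteq> topspace X"
    using assms unfolding locally_finite_in_def by blast
  fix x assume "x \<in> topspace X"
  then obtain V where V: "openin X V" "x \<in> V" "finite {U \<in> \<A>. U \<inter> V \<noteq> {}}"
    using assms unfolding locally_finite_in_def by blast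
  have "{U \<in> {\<Inter>F |F. F \<noteq> {} \<and> F \<subseteq> \<A>}. U \<inter> V \<noteq> {}} \<subseteq> Inter ` Pow {U \<in> \<A>. U \<inter> V \<noteq> {}}"
    by blast
  then have "finite {U \<in> {\<Inter>F |F. F \<noteq> {} \<and> F \<subseteq> \<A>}. U \<inter> V \<noteq> {}}"
    using V(3) by (meson finite_Pow_iff finite_imageI finite_subset)
  then show "\<exists>V. openin X V \<and> x \<in> V \<and> finite {U \<in> {\<Inter>F |F. F \<noteq> {} \<and> F \<subseteq> \<A>}. U \<inter> V \<noteq> {}}"
    using V by (intro exI[of _ V]) simp
qed

lemma regular_space_compact_open_closure:
  assumes "regular_space X" "compactin X K" "openin X U" "K \<subseteq> U"
  obtains W where "openin X W" "K \<subseteq> W" "X closure_of W \<subseteq> U"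
proof -
  have "closedin X (topspace X - U)" "disjnt K (topspace X - U)"
    using assms by (auto simp: disjnt_iff)
  then obtain W T where W: "openin X W" "openin X T" "K \<subseteq> W" "topspace X - U \<subseteq> T" "disjnt W T"
    using regular_space_compact_closed_separation[OF assms(1,2)] by meson
  have "X closure_of W \<subseteq> U"
  proof
    fix x assume "x \<in> X closure_of W"
    then show "x \<in> U" using W unfolding in_closure_of disjnt_iff by blast
  qed
  then show ?thesis using that W by blast
qed

text \<open>Closures preserve local finiteness, and regularity leaves room for them: the given
  network is applied inside an open \<open>W\<close> around \<open>K\<close> whose closure lies in
  \<open>U\<close>. Finite unions of levels give monotonicity, and intersections of nonempty
  subfamilies keep a level locally finite.\<close>

lemma aleph_space_imp_k_network_space:
  assumes "aleph_space X"
  shows "\<exists>N. k_network_space X N"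
proof -
  obtain \<C> where C: "countable \<C>" "\<And>\<A>. \<A> \<in> \<C> \<Longrightarrow> locally_finite_in X \<A>" "k_network_in X (\<Union>\<C>)"
    and reg: "regular_space X" and t1: "t1_space X"
    using assms unfolding aleph_space_def regular_t1_space_def by blast
  \<comment> \<open>Inserting \<open>{}\<close> makes the collection nonempty, as its enumeration by
    \<open>from_nat_into\<close> requires.\<close>
  define D where "D = from_nat_into (insert {} \<C>)"
  have D: "range D = insert {} \<C>"
    unfolding D_def using C(1) by (intro range_from_nat_into) auto
  have lfD: "locally_finite_in X (D n)" for n
    using C(2) rangeI[of D n] unfolding D by (auto simp: locally_finite_in_def)
  define M where "M i = (\<Union>j\<le>i. (\<lambda>S. X closure_of S) ` D j)" for i
  have lfM: "locally_finite_in X (M i)" for i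
  proof (induction i)
    case 0
    then show ?case using locally_finite_in_closure[OF lfD, of 0] by (simp add: M_def)
  next
    case (Suc i)
    have "M (Suc i) = M i \<union> (\<lambda>S. X closure_of S) ` D (Suc i)"
      by (auto simp: M_def atMost_Suc)
    then show ?case using locally_finite_in_Un[OF Suc locally_finite_in_closure[OF lfD]] by simp
  qed
  have monoM: "M i \<subseteq> M j" if "i \<le> j" for i j
    using that unfolding M_def by (intro UN_mono) auto
  define N where "N i = {\<Inter>F |F. F \<noteq> {} \<and> F \<subseteq> M i}" for i
  have MN: "A \<in> N i" if "A \<in> M i" for A i
    unfolding N_def using that by (intro CollectI exI[of _ "{A}"]) simp
  have "k_network_space X N"
  proof
    show "regular_space X" "t1_space X" by fact+
    show "locally_finite_in X (N i)" for i
      unfolding N_def by (rule locally_finite_in_Inters[OF lfM])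
    show "closedin X A" if "A \<in> N i" for A i
      using that unfolding N_def M_def by (auto intro!: closedin_Inter)
    show "N i \<subseteq> N j" if "i \<le> j" for i j
      using monoM[OF that] unfolding N_def by blast
    show "A \<inter> B \<in> N i" if AB: "A \<in> N i" "B \<in> N i" for A B i
    proof -
      obtain F where F: "A = \<Inter>F" "F \<noteq> {}" "F \<subseteq> M i"
        using AB(1) unfolding N_def by (elim CollectE exE conjE)
      obtain G where G: "B = \<Inter>G" "G \<subseteq> M i"
        using AB(2) unfolding N_def by (elim CollectE exE conjE)
      have "A \<inter> B = \<Inter>(F \<union> G)" using F(1) G(1) by (simp add: Inf_union_distrib)
      then show ?thesis unfolding N_def using F G by (intro CollectI exI[of _ "F \<union> G"]) simp
    qed
    fix U K assume UK: "openin X U" "compactin X K" "K \<subseteq> U"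
    obtain W where W: "openin X W" "K \<subseteq> W" "X closure_of W \<subseteq> U"
      using regular_space_compact_open_closure[OF reg UK(2,1,3)] by blast
    then obtain F where F: "finite F" "F \<subseteq> \<Union>\<C>" "K \<subseteq> \<Union>F" "\<Union>F \<subseteq> W"
      using C(3) UK(2) unfolding k_network_in_def by meson
    have "\<exists>j. S \<in> D j" if "S \<in> F" for S
    proof -
      obtain \<A> where "\<A> \<in> \<C>" "S \<in> \<A>" using \<open>S \<in> F\<close> F(2) by blast
      then show ?thesis using D by (metis insertCI rangeE)
    qed
    then obtain j where j: "\<And>S. S \<in> F \<Longrightarrow> S \<in> D (j S)" by metis
    obtain i where i: "\<And>S. S \<in> F \<Longrightarrow> j S \<le> i"
      using finite_nat_set_iff_bounded_le[of "j ` F"] F(1) by auto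
    have FX: "S \<subseteq> topspace X" if "S \<in> F" for S
      using that F(4) openin_subset[OF W(1)] by blast
    show "\<exists>i F. finite F \<and> F \<subseteq> N i \<and> K \<subseteq> \<Union>F \<and> \<Union>F \<subseteq> U"
    proof (intro exI conjI)
      show "finite ((\<lambda>S. X closure_of S) ` F)" using F(1) by simp
      have "(\<lambda>S. X closure_of S) ` F \<subseteq> M i"
        using i j unfolding M_def by blast
      then show "(\<lambda>S. X closure_of S) ` F \<subseteq> N i" using MN by blast
      show "K \<subseteq> \<Union>((\<lambda>S. X closure_of S) ` F)"
        using F(3) closure_of_subset[OF FX] by blast
      have "X closure_of S \<subseteq> U" if "S \<in> F" for S
        using closure_of_mono[of S W X] that F(4) W(3) by blast
      then show "\<Union>((\<lambda>S. X closure_of S) ` F) \<subseteq> U" by blast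
    qed
  qed
  then show ?thesis by (intro exI)
qed

lemma tychonoff_openin_imp_real_openin:
  assumes "tychonoff_space X" "openin X U"
  shows "real_openin X U"
  unfolding real_openin_def
proof (intro conjI ballI)
  show "U \<subseteq> topspace X" using assms(2) by (rule openin_subset)
  fix x assume "x \<in> U"
  then have "x \<in> topspace X - (topspace X - U)" "closedin X (topspace X - U)"
    using assms(2) openin_subset by auto
  then obtain f :: "'a \<Rightarrow> real" where f: "continuous_map X (top_of_set {0..1}) f" "f x = 0"
    "f ` (topspace X - U) \<subseteq> {1}"
    using assms(1) unfolding tychonoff_space_def completely_regular_space_def by meson
  have "continuous_map X (top_of_set {0..1}) (\<lambda>x. 1 - f x)"
    using f(1) by (auto simp: continuous_map_in_subtopology Pi_iff intro!: continuous_map_diff)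
  moreover have "(\<lambda>x. 1 - f x) ` (topspace X - U) \<subseteq> {0}" using f(3) by auto
  ultimately show "\<exists>f. continuous_map X (top_of_set {0..1::real}) f \<and> f x = 1 \<and>
      f ` (topspace X - U) \<subseteq> {0}"
    using f(2) by (intro exI[of _ "\<lambda>x. 1 - f x"]) simp
qed

lemma limitin_sequentiallyD:
  "limitin X \<sigma> l sequentially \<Longrightarrow> openin X U \<Longrightarrow> l \<in> U \<Longrightarrow> \<exists>k. \<forall>n\<ge>k. \<sigma> n \<in> U"
  by (simp add: limitin_sequentially)

lemma compactin_range_limit:
  assumes "limitin X y l sequentially" "\<And>n. y n \<in> topspace X"
  shows "compactin X (insert l (range y))"
  using compactin_sequence_with_limit[OF assms(1), of "range y"] assms(2) by blast

context k_network_space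
begin

text \<open>A Fin-fan would be strong, with unions of the sets \<open>V n y\<close> as
  neighbourhoods. If a compact set met infinitely many of these, a convergent sequence of meeting
  points would drag points of the \<open>F n\<close> to its limit; together with the limit they
  would form a compact set meeting infinitely many \<open>F n\<close>.\<close>

lemma compact_finite_imp_locally_finite:
  assumes tych: "tychonoff_space X" and nofan: "\<not> (\<exists>F. strong_Fin_fan X F)"
    and F: "\<And>n. finite (F n)" "\<And>n. F n \<subseteq> topspace X" and cf: "compact_finite_seq X F"
  shows "locally_finite_seq X F"
proof (rule ccontr)
  assume "\<not> locally_finite_seq X F"
  then have fan: "Fin_fan X F" using F cf by (simp add: Fin_fan_def)
  \<comment> \<open>The level rises with \<open>n\<close>, so that along any subsequence it tends to
    infinity, as \<open>V_limit\<close> demands.\<close>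
  define U where "U n = (\<Union>y\<in>F n. V n y)" for n
  have "openin X (U n)" for n unfolding U_def using openin_V by blast
  then have "real_openin X (U n)" for n using tychonoff_openin_imp_real_openin[OF tych] by blast
  moreover have "F n \<subseteq> U n" for n using F(2) V_self unfolding U_def by blast
  moreover have "compact_finite_seq X U"
    unfolding compact_finite_seq_def
  proof (intro allI impI, rule ccontr)
    fix K assume K: "compactin X K" and "infinite {n. U n \<inter> K \<noteq> {}}"
    then obtain r :: "nat \<Rightarrow> nat" where r: "strict_mono r" "\<And>k. U (r k) \<inter> K \<noteq> {}"
      using infinite_sets_strict_mono_selection[of "\<lambda>_. {n. U n \<inter> K \<noteq> {}}"] by auto
    have "\<exists>z y. z \<in> K \<and> y \<in> F (r k) \<and> z \<in> V (r k) y" for k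
      using r(2)[of k] unfolding U_def by blast
    then obtain z y where zy: "\<And>k. z k \<in> K" "\<And>k. y k \<in> F (r k)" "\<And>k. z k \<in> V (r k) (y k)"
      by metis
    obtain l s where s: "strict_mono s" "limitin X (z \<circ> s) l sequentially"
      using compactin_imp_seq[OF K, of z] zy(1) by blast
    have rs: "strict_mono (r \<circ> s)" using r(1) s(1) by (rule strict_mono_o)
    have "limitin X (y \<circ> s) l sequentially"
      by (rule V_limit[OF s(2) filterlim_subseq[OF rs]]) (simp add: zy)
    then have "compactin X (insert l (range (y \<circ> s)))"
      by (rule compactin_range_limit) (use zy(2) F(2) in auto)
    then have "finite {n. F n \<inter> insert l (range (y \<circ> s)) \<noteq> {}}"
      using cf unfolding compact_finite_seq_def by blast
    moreover have "range (r \<circ> s) \<subseteq> {n. F n \<inter> insert l (range (y \<circ> s)) \<noteq> {}}"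
      using zy(2) by auto
    ultimately show False
      using rs finite_subset range_inj_infinite strict_mono_imp_inj_on by blast
  qed
  ultimately have "strong_Fin_fan X F" unfolding strong_Fin_fan_def using fan by blast
  then show False using nofan by blast
qed

end

text \<open>Left multiplication by \<open>x\<close> is a self-homeomorphism of \<open>X\<close> with
  inverse \<open>dv x\<close>, sending \<open>e\<close> to \<open>x\<close>. Neither associativity
  nor a left unit is assumed, so the arguments move between \<open>x\<close> and \<open>e\<close>
  only by these maps and their joint continuity.\<close>

locale rectifiable_k_network_space = k_network_space +
  fixes e :: 'a and mul dv :: "'a \<Rightarrow> 'a \<Rightarrow> 'a"
  assumes e: "e \<in> topspace X"
    and mul_cont: "continuous_map (prod_topology X X) X (\<lambda>(x,y). mul x y)"
    and dv_cont: "continuous_map (prod_topology X X) X (\<lambda>(x,y). dv x y)"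
    and dv_same: "\<And>x. x \<in> topspace X \<Longrightarrow> dv x x = e"
    and mul_dv: "\<And>x y. x \<in> topspace X \<Longrightarrow> y \<in> topspace X \<Longrightarrow> mul x (dv x y) = y"
    and dv_mul: "\<And>x y. x \<in> topspace X \<Longrightarrow> y \<in> topspace X \<Longrightarrow> dv x (mul x y) = y"
    and no_fan: "\<And>F. (\<And>n. finite (F n)) \<Longrightarrow> (\<And>n. F n \<subseteq> topspace X) \<Longrightarrow>
                   compact_finite_seq X F \<Longrightarrow> locally_finite_seq X F"
    and kreal: "k_real_space X"
begin

lemma mul_in: "x \<in> topspace X \<Longrightarrow> y \<in> topspace X \<Longrightarrow> mul x y \<in> topspace X"
  using continuous_map_image_subset_topspace[OF mul_cont] by auto

lemma dv_in: "x \<in> topspace X \<Longrightarrow> y \<in> topspace X \<Longrightarrow> dv x y \<in> topspace X"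
  using continuous_map_image_subset_topspace[OF dv_cont] by auto

lemma mul_e: "x \<in> topspace X \<Longrightarrow> mul x e = x"
  using mul_dv[of x x] by (simp add: dv_same)

lemma mul_limit:
  assumes "limitin X a x sequentially" "limitin X b y sequentially"
  shows "limitin X (\<lambda>n. mul (a n) (b n)) (mul x y) sequentially"
proof -
  have "limitin (prod_topology X X) (\<lambda>n. (a n, b n)) (x,y) sequentially"
    using assms by (simp add: limitin_pairwise o_def)
  from continuous_map_limit[OF mul_cont this] show ?thesis by (simp add: o_def)
qed

lemma dv_limit:
  assumes "limitin X a x sequentially" "limitin X b y sequentially"
  shows "limitin X (\<lambda>n. dv (a n) (b n)) (dv x y) sequentially"
proof -
  have "limitin (prod_topology X X) (\<lambda>n. (a n, b n)) (x,y) sequentially"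
    using assms by (simp add: limitin_pairwise o_def)
  from continuous_map_limit[OF dv_cont this] show ?thesis by (simp add: o_def)
qed

lemma continuous_mul_left:
  assumes "x \<in> topspace X" shows "continuous_map X X (mul x)"
proof -
  have "continuous_map X (prod_topology X X) (\<lambda>y. (x,y))"
    using assms by (simp add: continuous_map_pairwise o_def)
  from continuous_map_compose[OF this mul_cont] show ?thesis by (simp add: o_def)
qed

lemma continuous_dv_left:
  assumes "x \<in> topspace X" shows "continuous_map X X (dv x)"
proof -
  have "continuous_map X (prod_topology X X) (\<lambda>y. (x,y))"
    using assms by (simp add: continuous_map_pairwise o_def)
  from continuous_map_compose[OF this dv_cont] show ?thesis by (simp add: o_def)
qed

text \<open>Metric fans at \<open>x\<close> (the \<open>D\<^sub>\<omega>\<close>-cofans of the literature) and sequential fans at \<open>e\<close> (the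
  \<open>S\<^sup>\<omega>\<close>-semifans). By homogeneity both need to be compared at \<open>e\<close> only.\<close>

definition cofan :: "'a \<Rightarrow> (nat \<Rightarrow> nat \<Rightarrow> 'a) \<Rightarrow> bool" where
  "cofan x d \<longleftrightarrow> (\<forall>n m. d n m \<in> topspace X) \<and>
     (\<forall>n K. compactin X K \<longrightarrow> finite {m. d n m \<in> K}) \<and>
     (\<forall>U. openin X U \<and> x \<in> U \<longrightarrow> (\<exists>n0. \<forall>n\<ge>n0. \<forall>m. d n m \<in> U))"

definition semifan :: "(nat \<Rightarrow> nat \<Rightarrow> 'a) \<Rightarrow> bool" where
  "semifan s \<longleftrightarrow> (\<forall>n m. s n m \<in> topspace X) \<and> (\<forall>n. limitin X (s n) e sequentially) \<and>
     (\<forall>K. compactin X K \<longrightarrow> finite {n. \<exists>m. s n m \<in> K})"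

lemma cofanD:
  "cofan x d \<Longrightarrow> openin X U \<Longrightarrow> x \<in> U \<Longrightarrow> \<exists>n0. \<forall>n\<ge>n0. \<forall>m. d n m \<in> U"
  by (simp add: cofan_def)

text \<open>Translating the \<open>n\<close>-th convergent sequence towards the points of the \<open>n\<close>-th sequence of the
  cofan produces points that cluster at \<open>e\<close> although every compact set contains only finitely many
  of them.\<close>

lemma not_cofan_semifan:
  assumes d: "cofan e d" and s: "semifan s"
  shows False
proof -
  have dX: "d n m \<in> topspace X" and sX: "s n m \<in> topspace X" for n m
    using d s unfolding cofan_def semifan_def by blast+
  have slim: "limitin X (s n) e sequentially" for n
    using s unfolding semifan_def by blast
  have ex: "\<exists>l. l \<ge> m \<and> mul (d n m) (s n l) \<in> V m (d n m)" for n m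
  proof -
    have "limitin X (\<lambda>l. mul (d n m) (s n l)) (d n m) sequentially"
      using mul_limit[OF _ slim, of "\<lambda>_. d n m" "d n m"] dX mul_e by simp
    from limitin_sequentiallyD[OF this openin_V V_self[OF dX]]
    obtain k where "\<forall>l\<ge>k. mul (d n m) (s n l) \<in> V m (d n m)" ..
    then show ?thesis by (intro exI[of _ "max k m"]) simp
  qed
  \<comment> \<open>Two demands: closeness to \<open>d n m\<close> lets \<open>V_limit\<close>
    recover convergence of the cofan points, and \<open>l \<ge> m\<close> drives
    \<open>s n (l n m)\<close> to \<open>e\<close> when \<open>m\<close> grows with \<open>n\<close>
    fixed.\<close>
  define l where "l n m = (SOME l. l \<ge> m \<and> mul (d n m) (s n l) \<in> V m (d n m))" for n m
  have l: "l n m \<ge> m" "mul (d n m) (s n (l n m)) \<in> V m (d n m)" for n m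
    using someI_ex[OF ex[of m n]] unfolding l_def by blast+
  define a where "a n m = mul (d n m) (s n (l n m))" for n m
  have aX: "a n m \<in> topspace X" for n m by (simp add: a_def mul_in dX sX)
  define F where "F k = {a (fst (prod_decode k)) (snd (prod_decode k))}" for k
  have fin: "finite {(n,m). a n m \<in> K}" if K: "compactin X K" for K
  proof (rule ccontr)
    assume inf: "infinite {(n,m). a n m \<in> K}"
    show False
    proof (cases "\<exists>n. infinite {m. a n m \<in> K}")
      \<comment> \<open>Infinitely many products from one row: a subsequence of \<open>d n\<close>
        inherits the limit and so stays in a compact set.\<close>
      case True
      then obtain n where n: "infinite {m. a n m \<in> K}" by blast
      obtain p r where r: "strict_mono r" "limitin X (a n \<circ> r) p sequentially"
        using compactin_imp_seq_infinite[OF K n] by blast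
      have "limitin X (d n \<circ> r) p sequentially"
        by (rule V_limit[OF r(2) filterlim_subseq[OF r(1)]]) (simp add: a_def l)
      then have "compactin X (insert p (range (d n \<circ> r)))"
        by (rule compactin_range_limit) (simp add: dX)
      then have "finite {m. d n m \<in> insert p (range (d n \<circ> r))}"
        using d unfolding cofan_def by blast
      moreover have "range r \<subseteq> {m. d n m \<in> insert p (range (d n \<circ> r))}" by auto
      ultimately show False
        using r(1) finite_subset range_inj_infinite strict_mono_imp_inj_on by blast
    next
      \<comment> \<open>Products from infinitely many rows: the cofan points tend to
        \<open>e\<close>, and dividing by them turns the convergent products back into a convergent
        sequence of terms from infinitely many \<open>s n\<close>.\<close>
      case False
      have "{(n,m). a n m \<in> K} \<subseteq> Sigma {n. \<exists>m. a n m \<in> K} (\<lambda>n. {m. a n m \<in> K})" by blast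
      moreover have "finite (Sigma A (\<lambda>n. {m. a n m \<in> K}))" if "finite A" for A
        using that False by blast
      ultimately have "infinite {n. \<exists>m. a n m \<in> K}"
        using inf finite_subset by blast
      then obtain r :: "nat \<Rightarrow> nat" where r: "strict_mono r" "\<And>k. \<exists>m. a (r k) m \<in> K"
        using infinite_sets_strict_mono_selection[of "\<lambda>_. {n. \<exists>m. a n m \<in> K}"] by auto
      then obtain m where m: "\<And>k. a (r k) (m k) \<in> K" by metis
      obtain p t where t: "strict_mono t" "limitin X ((\<lambda>k. a (r k) (m k)) \<circ> t) p sequentially"
        using compactin_imp_seq[OF K, of "\<lambda>k. a (r k) (m k)"] m by blast
      have rt: "strict_mono (r \<circ> t)" using r(1) t(1) by (rule strict_mono_o)
      have "limitin X (\<lambda>k. d (r (t k)) (m (t k))) e sequentially"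
        unfolding limitin_sequentially
      proof (intro conjI allI impI e)
        fix U assume "openin X U \<and> e \<in> U"
        then obtain n0 where "\<forall>n\<ge>n0. \<forall>m. d n m \<in> U" using d unfolding cofan_def by blast
        moreover have "k \<le> r (t k)" for k
          using strict_mono_imp_increasing[OF rt, of k] by simp
        ultimately show "\<exists>N. \<forall>k\<ge>N. d (r (t k)) (m (t k)) \<in> U"
          by (meson order_trans)
      qed
      then have "limitin X (\<lambda>k. dv (d (r (t k)) (m (t k))) (a (r (t k)) (m (t k)))) (dv e p) sequentially"
        using t(2) by (intro dv_limit) (simp_all add: o_def)
      then have lim: "limitin X (\<lambda>k. s (r (t k)) (l (r (t k)) (m (t k)))) (dv e p) sequentially"
        by (simp add: a_def dv_mul dX sX)
      have "compactin X (insert (dv e p) (range (\<lambda>k. s (r (t k)) (l (r (t k)) (m (t k))))))"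
        by (rule compactin_range_limit[OF lim]) (rule sX)
      then have "finite {n. \<exists>j. s n j \<in> insert (dv e p) (range (\<lambda>k. s (r (t k)) (l (r (t k)) (m (t k)))))}"
        using s unfolding semifan_def by blast
      moreover have "range (r \<circ> t) \<subseteq>
          {n. \<exists>j. s n j \<in> insert (dv e p) (range (\<lambda>k. s (r (t k)) (l (r (t k)) (m (t k)))))}"
        by auto
      ultimately show False
        using rt finite_subset range_inj_infinite strict_mono_imp_inj_on by blast
    qed
  qed
  have "compact_finite_seq X F"
    unfolding compact_finite_seq_def
  proof (intro allI impI)
    fix K assume "compactin X K"
    then have "finite (prod_encode ` {(n,m). a n m \<in> K})" using fin by blast
    moreover have "{k. F k \<inter> K \<noteq> {}} \<subseteq> prod_encode ` {(n,m). a n m \<in> K}"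
    proof
      fix k assume "k \<in> {k. F k \<inter> K \<noteq> {}}"
      then have "prod_decode k \<in> {(n,m). a n m \<in> K}"
        by (simp add: F_def case_prod_beta)
      then show "k \<in> prod_encode ` {(n,m). a n m \<in> K}"
        by (metis image_eqI prod_decode_inverse)
    qed
    ultimately show "finite {k. F k \<inter> K \<noteq> {}}" using finite_subset by blast
  qed
  then have "locally_finite_seq X F"
    by (intro no_fan) (auto simp: F_def aX)
  then obtain W where W: "openin X W" "e \<in> W" "finite {k. F k \<inter> W \<noteq> {}}"
    using e unfolding locally_finite_seq_def by blast
  \<comment> \<open>Since \<open>mul e e = e\<close>, a late row of the cofan times late terms of
    the matching sequence falls into \<open>W\<close>; this one row already gives infinitely many
    indices.\<close>
  define P where "P = {p \<in> topspace (prod_topology X X). (\<lambda>(x,y). mul x y) p \<in> W}"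
  have "openin (prod_topology X X) P"
    unfolding P_def by (rule openin_continuous_map_preimage[OF mul_cont W(1)])
  moreover have "(e,e) \<in> P"
    using e W(2) mul_e by (simp add: P_def)
  ultimately obtain A B where AB: "openin X A" "openin X B" "e \<in> A" "e \<in> B" "A \<times> B \<subseteq> P"
    unfolding openin_prod_topology_alt by meson
  obtain n where n: "\<And>m. d n m \<in> A"
    using cofanD[OF d AB(1,3)] by blast
  obtain j where j: "\<And>i. i \<ge> j \<Longrightarrow> s n i \<in> B"
    using limitin_sequentiallyD[OF slim[of n] AB(2,4)] by blast
  have "a n m \<in> W" if "m \<ge> j" for m
  proof -
    have "(d n m, s n (l n m)) \<in> A \<times> B" using n j l(1)[of m n] that by auto
    then show ?thesis using AB(5) unfolding a_def P_def by auto
  qed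
  then have "(\<lambda>m. prod_encode (n,m)) ` {j..} \<subseteq> {k. F k \<inter> W \<noteq> {}}" by (auto simp: F_def)
  then have "finite ((\<lambda>m. prod_encode (n,m)) ` {j..})" using W(3) finite_subset by blast
  moreover have "inj_on (\<lambda>m. prod_encode (n,m)) {j..}" by (auto simp: inj_on_def)
  ultimately show False using finite_imageD infinite_Ici by blast
qed

text \<open>The homeomorphism \<open>dv x\<close> takes \<open>x\<close> to \<open>e\<close>, and
  its inverse \<open>mul x\<close> carries compact sets back.\<close>

lemma cofan_translate:
  assumes "x \<in> topspace X" "cofan x d"
  shows "cofan e (\<lambda>n m. dv x (d n m))"
proof -
  have dX: "d n m \<in> topspace X" for n m using assms(2) unfolding cofan_def by blast
  show ?thesis
    unfolding cofan_def
  proof (intro conjI allI impI)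
    show "dv x (d n m) \<in> topspace X" for n m using dv_in assms(1) dX by blast
    show "finite {m. dv x (d n m) \<in> K}" if K: "compactin X K" for n K
    proof -
      have "compactin X (mul x ` K)"
        by (rule image_compactin[OF K continuous_mul_left[OF assms(1)]])
      then have "finite {m. d n m \<in> mul x ` K}" using assms(2) unfolding cofan_def by blast
      moreover have "{m. dv x (d n m) \<in> K} \<subseteq> {m. d n m \<in> mul x ` K}"
        using mul_dv[OF assms(1) dX] by (metis (mono_tags, lifting) Collect_mono imageI)
      ultimately show ?thesis using finite_subset by blast
    qed
    show "\<exists>n0. \<forall>n\<ge>n0. \<forall>m. dv x (d n m) \<in> U" if U: "openin X U \<and> e \<in> U" for U
    proof -
      have "openin X {y \<in> topspace X. dv x y \<in> U}"
        using openin_continuous_map_preimage[OF continuous_dv_left[OF assms(1)]] U by blast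
      moreover have "x \<in> {y \<in> topspace X. dv x y \<in> U}" using assms(1) U dv_same by simp
      ultimately obtain n0 where "\<forall>n\<ge>n0. \<forall>m. d n m \<in> {y \<in> topspace X. dv x y \<in> U}"
        using cofanD[OF assms(2)] by metis
      then show ?thesis by blast
    qed
  qed
qed

end

section \<open>Convergent sequences and fans\<close>

context k_network_space
begin

text \<open>The part of \<open>K\<close> that is mapped into a closed set is sequentially compact,
  hence compact, hence closed in the Hausdorff space \<open>X\<close>.\<close>

lemma continuous_map_compact_seq:
  fixes f :: "'a \<Rightarrow> real"
  assumes K: "compactin X K"
    and f: "\<And>\<sigma> x. limitin X \<sigma> x sequentially \<Longrightarrow> (\<And>n. \<sigma> n \<in> K) \<Longrightarrow> x \<in> K \<Longrightarrow> (\<lambda>n. f (\<sigma> n)) \<longlonglongrightarrow> f x"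
  shows "continuous_map (subtopology X K) euclideanreal f"
  unfolding continuous_map_closedin
proof (intro conjI allI impI ballI)
  fix C assume "closedin euclideanreal C"
  then have C: "closed C" by simp
  have KX: "K \<subseteq> topspace X" using K by (rule compactin_subset_topspace)
  define A where "A = {x \<in> K. f x \<in> C}"
  have "compactin X A"
  proof (rule seq_imp_compactin)
    show "A \<subseteq> topspace X" using KX by (auto simp: A_def)
    fix z :: "nat \<Rightarrow> 'a" assume z: "\<And>n. z n \<in> A"
    then have zK: "z n \<in> K" for n by (simp add: A_def)
    obtain l r where l: "l \<in> K" "strict_mono r" "limitin X (z \<circ> r) l sequentially"
      using compactin_imp_seq[of K z, OF K zK] by blast
    have "(\<lambda>n. f ((z \<circ> r) n)) \<longlonglongrightarrow> f l"
      by (rule f[OF l(3) _ l(1)]) (simp add: zK)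
    moreover have "f ((z \<circ> r) n) \<in> C" for n using z by (simp add: A_def)
    ultimately have "f l \<in> C" using C closed_sequentially by metis
    then show "\<exists>l\<in>A. \<exists>r. strict_mono r \<and> limitin X (z \<circ> r) l sequentially"
      using l by (auto simp: A_def)
  qed
  then have "closedin X A" by (rule compactin_imp_closedin[OF Hausdorff])
  then have "closedin (subtopology X K) A"
    by (rule closedin_subset_topspace) (auto simp: A_def)
  moreover have "{x \<in> topspace (subtopology X K). f x \<in> C} = A"
    using KX by (auto simp: A_def)
  ultimately show "closedin (subtopology X K) {x \<in> topspace (subtopology X K). f x \<in> C}" by simp
qed simp

text \<open>The gate through which \<open>k_real_space\<close> enters: later, openness in
  \<open>X\<close> is obtained from functions that pass this sequential test.\<close>

lemma k_real_continuous_seq: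
  fixes f :: "'a \<Rightarrow> real"
  assumes k: "k_real_space X"
    and f: "\<And>\<sigma> x. limitin X \<sigma> x sequentially \<Longrightarrow> (\<And>n. \<sigma> n \<in> topspace X) \<Longrightarrow> (\<lambda>n. f (\<sigma> n)) \<longlonglongrightarrow> f x"
  shows "continuous_map X euclideanreal f"
proof -
  have "continuous_map (subtopology X K) euclideanreal f" if K: "compactin X K" for K
    using continuous_map_compact_seq[OF K, of f] f compactin_subset_topspace[OF K] by blast
  then show ?thesis using k unfolding k_real_space_def by blast
qed

text \<open>Failure of sequential compactness gives a sequence with no subsequence converging in
  \<open>C\<close>. As \<open>C\<close> is closed, no subsequence converges at all, so a compact set
  cannot contain infinitely many terms.\<close>

lemma not_compactin_imp_sequence:
  assumes C: "closedin X C" "\<not> compactin X C"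
  shows "\<exists>z :: nat \<Rightarrow> 'a. (\<forall>n. z n \<in> C) \<and> (\<forall>K. compactin X K \<longrightarrow> finite {n. z n \<in> K})"
proof -
  obtain z :: "nat \<Rightarrow> 'a" where z: "\<And>n. z n \<in> C"
    "\<not> (\<exists>l\<in>C. \<exists>r. strict_mono r \<and> limitin X (z \<circ> r) l sequentially)"
    using seq_imp_compactin[OF closedin_subset[OF C(1)]] C(2) by blast
  have "finite {n. z n \<in> K}" if K: "compactin X K" for K
  proof (rule ccontr)
    assume inf: "infinite {n. z n \<in> K}"
    obtain l r where r: "strict_mono r" "limitin X (z \<circ> r) l sequentially"
      using compactin_imp_seq_infinite[OF K inf] by blast
    then have "l \<in> C"
      using limitin_closedin[OF r(2) C(1)] z(1) by simp
    then show False using z(2) r by blast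
  qed
  then show ?thesis using z(1) by blast
qed

lemma eventually_notin_closed:
  assumes "limitin X \<sigma> x sequentially" "closedin X A" "x \<notin> A"
  shows "\<forall>\<^sub>F n in sequentially. \<sigma> n \<notin> A"
proof -
  have "openin X (topspace X - A)" "x \<in> topspace X - A"
    using assms limitin_topspace by fastforce+
  then have "\<forall>\<^sub>F n in sequentially. \<sigma> n \<in> topspace X - A"
    using assms(1) unfolding limitin_def by blast
  then show ?thesis by (rule eventually_mono) simp
qed

lemma knet_point:
  assumes "openin X U" "x \<in> U"
  obtains i A where "A \<in> N i" "x \<in> A" "A \<subseteq> U"
proof -
  have "compactin X {x}" "{x} \<subseteq> U"
    using assms subsetD[OF openin_subset[OF assms(1)] assms(2)] by simp_all
  from knet[OF assms(1) this] obtain i F where F: "F \<subseteq> N i" "{x} \<subseteq> \<Union>F" "\<Union>F \<subseteq> U"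
    by (elim exE conjE)
  then have "x \<in> \<Union>F" by simp
  then obtain A where "A \<in> F" "x \<in> A" by (rule UnionE)
  then show ?thesis using that[of A i] F by auto
qed

text \<open>Members of the network that miss the limit contain only finitely many terms, so they can be
  discarded.\<close>

lemma knet_sequence:
  assumes lim: "limitin X \<sigma> x sequentially" and U: "openin X U" "x \<in> U"
  shows "\<exists>F. finite F \<and> F \<subseteq> {A \<in> (\<Union>i. N i). x \<in> A} \<and> \<Union>F \<subseteq> U \<and>
    (\<forall>\<^sub>F n in sequentially. \<sigma> n \<in> \<Union>F)"
proof -
  obtain m where m: "\<forall>k\<ge>m. \<sigma> k \<in> U" "compactin X (insert x (\<sigma> ` {m..}))"
    using limitin_tail_compact[OF lim U] by blast
  have sub: "insert x (\<sigma> ` {m..}) \<subseteq> U" using m(1) U(2) by auto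
  from knet[OF U(1) m(2) sub] obtain i F where F: "finite F" "F \<subseteq> N i"
    "insert x (\<sigma> ` {m..}) \<subseteq> \<Union>F" "\<Union>F \<subseteq> U"
    by (elim exE conjE)
  have "\<forall>A\<in>{A \<in> F. x \<notin> A}. \<forall>\<^sub>F n in sequentially. \<sigma> n \<notin> A"
    using eventually_notin_closed[OF lim] clo F(2) by blast
  then have "\<forall>\<^sub>F n in sequentially. \<forall>A\<in>{A \<in> F. x \<notin> A}. \<sigma> n \<notin> A"
    using F(1) by (intro eventually_ball_finite) auto
  moreover have "\<forall>\<^sub>F n in sequentially. \<sigma> n \<in> \<Union>F"
    using F(3) by (auto intro!: eventually_sequentiallyI[of m])
  ultimately have "\<forall>\<^sub>F n in sequentially. \<sigma> n \<in> \<Union>{A \<in> F. x \<in> A}"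
    by eventually_elim blast
  moreover have "{A \<in> F. x \<in> A} \<subseteq> {A \<in> (\<Union>i. N i). x \<in> A}" using F(2) by blast
  moreover have "finite {A \<in> F. x \<in> A}" "\<Union>{A \<in> F. x \<in> A} \<subseteq> U" using F(1,4) by auto
  ultimately show ?thesis by blast
qed

end

context rectifiable_k_network_space
begin

text \<open>The finite families of network members through \<open>x\<close> that eventually trap
  \<open>\<sigma>\<close> are countably many and can be intersected, so a sequence of their unions
  shrinks to \<open>x\<close>. If none of these closed unions were compact, each would contain a
  sequence escaping compact sets; these would be the rows of a metric fan at \<open>x\<close>, which
  translates to \<open>e\<close>.\<close>

lemma no_cofan_compact_cover:
  assumes no: "\<And>d. \<not> cofan e d"
    and lim: "limitin X \<sigma> x sequentially"
  shows "\<exists>F. finite F \<and> F \<subseteq> (\<Union>i. N i) \<and> (\<forall>A\<in>F. x \<in> A \<and> compactin X A) \<and>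
    (\<forall>\<^sub>F n in sequentially. \<sigma> n \<in> \<Union>F)"
proof -
  have x: "x \<in> topspace X" using lim by (rule limitin_topspace)
  define good where "good F \<longleftrightarrow> finite F \<and> F \<subseteq> {A \<in> (\<Union>i. N i). x \<in> A} \<and>
    (\<forall>\<^sub>F n in sequentially. \<sigma> n \<in> \<Union>F)" for F
  have small: "\<exists>F. good F \<and> \<Union>F \<subseteq> U" if U: "openin X U" "x \<in> U" for U
  proof -
    from knet_sequence[OF lim U] obtain F where "finite F" "F \<subseteq> {A \<in> (\<Union>i. N i). x \<in> A}"
      "\<Union>F \<subseteq> U" "\<forall>\<^sub>F n in sequentially. \<sigma> n \<in> \<Union>F"
      by (elim exE conjE)
    then show ?thesis unfolding good_def by (intro exI conjI)
  qed
  have inter: "\<exists>H. good H \<and> \<Union>H \<subseteq> \<Union>F \<inter> \<Union>G" if F: "good F" and G: "good G" for F G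
  proof (intro exI conjI)
    let ?H = "(\<lambda>(A,B). A \<inter> B) ` (F \<times> G)"
    have un: "\<Union>?H = \<Union>F \<inter> \<Union>G" by auto
    then show "\<Union>?H \<subseteq> \<Union>F \<inter> \<Union>G" by simp
    have "\<forall>\<^sub>F n in sequentially. \<sigma> n \<in> \<Union>?H"
      using F G unfolding un good_def by (simp add: eventually_conj_iff)
    moreover have "A \<inter> B \<in> {A \<in> (\<Union>i. N i). x \<in> A}" if AB: "A \<in> F" "B \<in> G" for A B
    proof -
      obtain i j where "A \<in> N i" "B \<in> N j" "x \<in> A" "x \<in> B"
        using AB F G unfolding good_def by blast
      then have "A \<in> N (max i j)" "B \<in> N (max i j)"
        using mono[of i "max i j"] mono[of j "max i j"] by auto
      then show ?thesis using int \<open>x \<in> A\<close> \<open>x \<in> B\<close> by blast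
    qed
    ultimately show "good ?H" using F G unfolding good_def
      by (intro conjI) (auto simp del: UN_iff UN_simps)
  qed
  have cnt: "countable {F. good F}"
  proof -
    have "{F. good F} \<subseteq> {F. finite F \<and> F \<subseteq> {A \<in> (\<Union>i. N i). x \<in> A}}"
      unfolding good_def by blast
    then show ?thesis
      by (rule countable_subset[OF _ countable_Collect_finite_subset[OF point_countable[OF x]]])
  qed
  have ne: "{F. good F} \<noteq> {}" using small[OF openin_topspace x] by auto
  define G where "G = from_nat_into {F. good F}"
  have G: "good (G n)" for n using from_nat_into[OF ne] unfolding G_def by blast
  have ex: "\<exists>H. good H \<and> (\<forall>i\<le>n. \<Union>H \<subseteq> \<Union>(G i))" for n
  proof (induction n)
    case 0
    then show ?case using G[of 0] by (intro exI[of _ "G 0"]) simp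
  next
    case (Suc n)
    then obtain H where H: "good H" "\<forall>i\<le>n. \<Union>H \<subseteq> \<Union>(G i)" by (elim exE conjE)
    from inter[OF H(1) G[of "Suc n"]]
    obtain H' where H': "good H'" "\<Union>H' \<subseteq> \<Union>H \<inter> \<Union>(G (Suc n))"
      by (elim exE conjE)
    have "\<Union>H' \<subseteq> \<Union>(G i)" if "i \<le> Suc n" for i
    proof (cases "i = Suc n")
      case True
      then show ?thesis using H'(2) by simp
    next
      case False
      then have "\<Union>H \<subseteq> \<Union>(G i)" using that H(2) by simp
      then show ?thesis using H'(2) by (meson Int_lower1 subset_trans)
    qed
    then show ?case using H'(1) by (intro exI[of _ H'] conjI allI impI)
  qed
  \<comment> \<open>The union of \<open>H n\<close> lies inside those of \<open>G 0\<close>, ...,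
    \<open>G n\<close>, and \<open>G\<close> enumerates all trapping families, so these unions
    eventually enter every neighbourhood of \<open>x\<close>.\<close>
  define H where "H n = (SOME H. good H \<and> (\<forall>i\<le>n. \<Union>H \<subseteq> \<Union>(G i)))" for n
  have "good (H n) \<and> (\<forall>i\<le>n. \<Union>(H n) \<subseteq> \<Union>(G i))" for n
    unfolding H_def by (rule someI_ex[OF ex])
  then have H: "\<And>n. good (H n)" "\<And>n i. i \<le> n \<Longrightarrow> \<Union>(H n) \<subseteq> \<Union>(G i)"
    by simp_all
  have cloH: "closedin X A" if "A \<in> H n" for A n
  proof -
    have "A \<in> (\<Union>i. N i)" using that H(1)[of n] unfolding good_def by auto
    then show ?thesis using clo by auto
  qed
  show ?thesis
  proof (cases "\<exists>n. compactin X (\<Union>(H n))")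
    case True
    then obtain n where n: "compactin X (\<Union>(H n))" ..
    have "compactin X A" if "A \<in> H n" for A
      by (rule closed_compactin[OF n Union_upper[OF that] cloH[OF that]])
    moreover have "H n \<subseteq> {A \<in> (\<Union>i. N i). x \<in> A}" "finite (H n)"
      "\<forall>\<^sub>F k in sequentially. \<sigma> k \<in> \<Union>(H n)"
      using H(1)[of n] unfolding good_def by simp_all
    ultimately show ?thesis by (intro exI[of _ "H n"]) auto
  next
    case False
    have "\<exists>z :: nat \<Rightarrow> 'a. (\<forall>m. z m \<in> \<Union>(H n)) \<and> (\<forall>K. compactin X K \<longrightarrow> finite {m. z m \<in> K})" for n
    proof (rule not_compactin_imp_sequence)
      show "closedin X (\<Union>(H n))"
        using H(1)[of n] cloH by (intro closedin_Union) (auto simp: good_def)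
      show "\<not> compactin X (\<Union>(H n))" using False by simp
    qed
    then have "\<exists>d :: nat \<Rightarrow> nat \<Rightarrow> 'a. \<forall>n. (\<forall>m. d n m \<in> \<Union>(H n)) \<and>
        (\<forall>K. compactin X K \<longrightarrow> finite {m. d n m \<in> K})"
      by (intro choice allI)
    then obtain d :: "nat \<Rightarrow> nat \<Rightarrow> 'a" where d0: "\<forall>n. (\<forall>m. d n m \<in> \<Union>(H n)) \<and>
        (\<forall>K. compactin X K \<longrightarrow> finite {m. d n m \<in> K})"
      by (elim exE)
    have d: "\<And>n m. d n m \<in> \<Union>(H n)" "\<And>n K. compactin X K \<Longrightarrow> finite {m. d n m \<in> K}"
      using d0 by metis+
    have "cofan x d"
      unfolding cofan_def
    proof (intro conjI allI impI)
      show "d n m \<in> topspace X" for n m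
        using d(1)[of n m] closedin_subset[OF cloH[of _ n]] by auto
      show "finite {m. d n m \<in> K}" if "compactin X K" for n K using d(2) that .
      fix U assume U: "openin X U \<and> x \<in> U"
      then obtain F where F: "good F" "\<Union>F \<subseteq> U" using small by blast
      then obtain i where i: "G i = F"
        using from_nat_into_surj[OF cnt, of F] unfolding G_def by auto
      have "d n m \<in> U" if "n \<ge> i" for n m
        using subsetD[OF H(2)[OF that] d(1)] F(2) by (auto simp: i)
      then show "\<exists>n0. \<forall>n\<ge>n0. \<forall>m. d n m \<in> U" by blast
    qed
    from cofan_translate[OF x this] no show ?thesis by simp
  qed
qed

section \<open>Sequential closure in the absence of sequential fans\<close>

definition seqcl :: "'a set \<Rightarrow> 'a set" where
  "seqcl B = {x. \<exists>\<sigma>. (\<forall>n. \<sigma> n \<in> B) \<and> limitin X \<sigma> x sequentially}"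

lemma seqcl_subset: "B \<subseteq> topspace X \<Longrightarrow> B \<subseteq> seqcl B"
  unfolding seqcl_def using limitin_const_iff[of X] by fastforce

lemma seqcl_topspace: "seqcl B \<subseteq> topspace X"
  unfolding seqcl_def using limitin_topspace by fastforce

text \<open>A compact set that meets infinitely many of the sequences yields a convergent choice of
  one term each. The limit is not yet known to be \<open>e\<close>; the callers identify it through
  the sets \<open>V n y\<close>.\<close>

lemma not_semifan_dest:
  assumes no: "\<not> semifan s" and sX: "\<And>n m. s n m \<in> topspace X"
    and lim: "\<And>n. limitin X (s n) e sequentially"
  shows "\<exists>r m l. strict_mono r \<and> limitin X (\<lambda>k. s (r k) (m k)) l sequentially"
proof -
  obtain K where K: "compactin X K" "infinite {n. \<exists>m. s n m \<in> K}"
    using assms unfolding semifan_def by blast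
  then obtain r :: "nat \<Rightarrow> nat" where r: "strict_mono r" "\<And>k. \<exists>m. s (r k) m \<in> K"
    using infinite_sets_strict_mono_selection[of "\<lambda>_. {n. \<exists>m. s n m \<in> K}"] by auto
  then obtain m where m: "\<And>k. s (r k) (m k) \<in> K" by metis
  obtain l t where t: "strict_mono t" "limitin X ((\<lambda>k. s (r k) (m k)) \<circ> t) l sequentially"
    using compactin_imp_seq[OF K(1), of "\<lambda>k. s (r k) (m k)"] m by blast
  have "strict_mono (r \<circ> t)" using r(1) t(1) by (rule strict_mono_o)
  moreover have "limitin X (\<lambda>k. s ((r \<circ> t) k) ((m \<circ> t) k)) l sequentially"
    using t(2) by (simp add: o_def)
  ultimately show ?thesis by blast
qed

text \<open>Diagonalisation is possible at \<open>e\<close> because there are no sequential fans.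
  Sequences in \<open>B\<close> converging to the points \<open>y n\<close> are divided by
  \<open>y n\<close> and then converge to \<open>e\<close>; a convergent diagonal of quotients,
  multiplied back, is a convergent diagonal in \<open>B\<close>.\<close>

lemma seqcl_idem:
  assumes no: "\<And>s. \<not> semifan s" and B: "B \<subseteq> topspace X"
    and y: "\<And>n. y n \<in> seqcl B" and lim: "limitin X y x sequentially"
  shows "x \<in> seqcl B"
proof -
  have yX: "y n \<in> topspace X" for n using y seqcl_topspace by blast
  have "\<exists>\<sigma>. (\<forall>k. \<sigma> k \<in> B) \<and> limitin X \<sigma> (y n) sequentially" for n
    using y[of n] unfolding seqcl_def by blast
  then obtain \<sigma> where s: "\<And>n k. \<sigma> n k \<in> B" "\<And>n. limitin X (\<sigma> n) (y n) sequentially"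
    by metis
  have "\<exists>j. \<forall>k\<ge>j. \<sigma> n k \<in> V n (y n)" for n
    by (rule limitin_sequentiallyD[OF s(2) openin_V V_self[OF yX]])
  then obtain j where j: "\<And>n k. k \<ge> j n \<Longrightarrow> \<sigma> n k \<in> V n (y n)" by metis
  \<comment> \<open>Initial terms are dropped so that all of row \<open>n\<close> lies in
    \<open>V n (y n)\<close>, which later identifies the limit of the diagonal.\<close>
  define \<tau> where "\<tau> n m = \<sigma> n (m + j n)" for n m
  have \<tau>_eq: "\<tau> n = (\<lambda>m. \<sigma> n (m + j n))" for n
    by (simp add: \<tau>_def fun_eq_iff)
  have \<tau>: "\<tau> n m \<in> B" "\<tau> n m \<in> V n (y n)" "limitin X (\<tau> n) (y n) sequentially" for n m
    using s j limitin_sequentially_offset[OF s(2)[of n]] \<tau>_eq by (auto simp: \<tau>_def)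
  have \<tau>X: "\<tau> n m \<in> topspace X" for n m using \<tau>(1) B by blast
  have "\<exists>r m l. strict_mono r \<and> limitin X (\<lambda>k. dv (y (r k)) (\<tau> (r k) (m k))) l sequentially"
  proof (rule not_semifan_dest[OF no])
    show "dv (y n) (\<tau> n m) \<in> topspace X" for n m using dv_in yX \<tau>X by blast
    show "limitin X (\<lambda>m. dv (y n) (\<tau> n m)) e sequentially" for n
      using dv_limit[OF _ \<tau>(3), of "\<lambda>_. y n" "y n" n] dv_same[OF yX[of n]] yX by simp
  qed
  then obtain r m l where r: "strict_mono r"
    "limitin X (\<lambda>k. dv (y (r k)) (\<tau> (r k) (m k))) l sequentially"
    by blast
  have yr: "limitin X (\<lambda>k. y (r k)) x sequentially"
    using limitin_subsequence[OF r(1) lim] by (simp add: o_def)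
  have \<tau>r: "limitin X (\<lambda>k. \<tau> (r k) (m k)) (mul x l) sequentially"
    using mul_limit[OF yr r(2)] by (simp add: mul_dv yX \<tau>X)
  \<comment> \<open>The diagonal drags the points \<open>y (r k)\<close> to its own limit
    \<open>mul x l\<close>; as they also tend to \<open>x\<close>, that limit is
    \<open>x\<close>.\<close>
  have "limitin X (\<lambda>k. y (r k)) (mul x l) sequentially"
    by (rule V_limit[OF \<tau>r filterlim_subseq[OF r(1)]]) (rule \<tau>(2))
  then have "mul x l = x" using yr limit_unique by blast
  then show ?thesis
    using \<tau>r \<tau>(1) unfolding seqcl_def by (intro CollectI exI[of _ "\<lambda>k. \<tau> (r k) (m k)"]) simp
qed

text \<open>Otherwise, with the countably many members through \<open>e\<close> inside
  \<open>U\<close> enumerated as \<open>A\<close>, sequences avoiding \<open>A 0\<close>, ...,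
  \<open>A n\<close> converge to \<open>e\<close> for each \<open>n\<close>. A convergent diagonal
  of them tends to \<open>e\<close> and eventually leaves each \<open>A i\<close>, yet finitely many
  of the \<open>A i\<close> must trap it.\<close>

lemma seq_neighbourhood:
  assumes no: "\<And>s. \<not> semifan s" and U: "openin X U" "e \<in> U"
  shows "\<exists>F. finite F \<and> F \<subseteq> {A \<in> (\<Union>i. N i). e \<in> A} \<and> \<Union>F \<subseteq> U \<and> e \<notin> seqcl (topspace X - \<Union>F)"
proof (rule ccontr)
  assume neg: "\<not> ?thesis"
  define P where "P = {A \<in> {A \<in> (\<Union>i. N i). e \<in> A}. A \<subseteq> U}"
  have cP: "countable P"
    unfolding P_def by (rule countable_subset[OF _ point_countable[OF e]]) blast
  have neP: "P \<noteq> {}"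
    using knet_point[OF U] unfolding P_def by (metis (mono_tags, lifting) UN_iff UNIV_I empty_iff mem_Collect_eq)
  define A where "A = from_nat_into P"
  have A: "A n \<in> P" for n using from_nat_into[OF neP] by (simp add: A_def)
  have "e \<in> seqcl (topspace X - \<Union>(A ` {..j}))" for j
  proof (rule ccontr)
    assume "e \<notin> seqcl (topspace X - \<Union>(A ` {..j}))"
    moreover have "finite (A ` {..j})" "A ` {..j} \<subseteq> {A \<in> (\<Union>i. N i). e \<in> A}" "\<Union>(A ` {..j}) \<subseteq> U"
      using A unfolding P_def by blast+
    ultimately show False using neg by blast
  qed
  then have "\<exists>\<sigma>. (\<forall>k. \<sigma> k \<in> topspace X - \<Union>(A ` {..n})) \<and> limitin X \<sigma> e sequentially" for n
    unfolding seqcl_def by blast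
  then obtain \<sigma> where s: "\<And>n k. \<sigma> n k \<in> topspace X - \<Union>(A ` {..n})" "\<And>n. limitin X (\<sigma> n) e sequentially"
    by metis
  have "\<exists>j. \<forall>k\<ge>j. \<sigma> n k \<in> V n e" for n
    by (rule limitin_sequentiallyD[OF s(2) openin_V V_self[OF e]])
  then obtain j where j: "\<And>n k. k \<ge> j n \<Longrightarrow> \<sigma> n k \<in> V n e" by metis
  define \<tau> where "\<tau> n m = \<sigma> n (m + j n)" for n m
  have \<tau>_eq: "\<tau> n = (\<lambda>m. \<sigma> n (m + j n))" for n
    by (simp add: \<tau>_def fun_eq_iff)
  have \<tau>: "\<tau> n m \<in> topspace X - \<Union>(A ` {..n})" "\<tau> n m \<in> V n e" "limitin X (\<tau> n) e sequentially" for n m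
    using s j limitin_sequentially_offset[OF s(2)[of n]] \<tau>_eq by (auto simp: \<tau>_def)
  have "\<exists>r m l. strict_mono r \<and> limitin X (\<lambda>k. \<tau> (r k) (m k)) l sequentially"
    by (rule not_semifan_dest[OF no]) (use \<tau> in blast)+
  then obtain r m l where r: "strict_mono r" "limitin X (\<lambda>k. \<tau> (r k) (m k)) l sequentially"
    by blast
  have "l = e"
    by (rule V_limit_const[OF r(2) filterlim_subseq[OF r(1)] _ e]) (rule \<tau>(2))
  then have lim: "limitin X (\<lambda>k. \<tau> (r k) (m k)) e sequentially" using r(2) by simp
  from knet_sequence[OF lim U] obtain F where F: "finite F" "F \<subseteq> {A \<in> (\<Union>i. N i). e \<in> A}" "\<Union>F \<subseteq> U"
    "\<forall>\<^sub>F k in sequentially. \<tau> (r k) (m k) \<in> \<Union>F"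
    by (elim exE conjE)
  have "\<forall>B\<in>F. \<forall>\<^sub>F k in sequentially. \<tau> (r k) (m k) \<notin> B"
  proof
    fix B assume "B \<in> F"
    then have "B \<in> P" using F(2,3) unfolding P_def by blast
    then obtain i where i: "A i = B" using from_nat_into_surj[OF cP] unfolding A_def by blast
    have "\<tau> (r k) (m k) \<notin> B" if "k \<ge> i" for k
    proof -
      have "i \<le> r k" using strict_mono_imp_increasing[OF r(1), of k] that by simp
      then show ?thesis using \<tau>(1)[of "r k" "m k"] i by auto
    qed
    then show "\<forall>\<^sub>F k in sequentially. \<tau> (r k) (m k) \<notin> B" by (rule eventually_sequentiallyI)
  qed
  then have "\<forall>\<^sub>F k in sequentially. \<forall>B\<in>F. \<tau> (r k) (m k) \<notin> B"
    using F(1) by (intro eventually_ball_finite)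
  with F(4) have "\<forall>\<^sub>F k::nat in sequentially. False"
    by eventually_elim blast
  then show False by simp
qed

end

section \<open>The sequential coreflection\<close>

text \<open>The finest topology on \<open>topspace X\<close> in which the sequences converging in
  \<open>X\<close> keep their limits.\<close>

definition sequential_topology :: "'a topology \<Rightarrow> 'a topology" where
  "sequential_topology X = topology (\<lambda>U. U \<subseteq> topspace X \<and>
     (\<forall>\<sigma> x. x \<in> U \<and> (\<forall>n. \<sigma> n \<in> topspace X) \<and> limitin X \<sigma> x sequentially \<longrightarrow>
        (\<forall>\<^sub>F n in sequentially. \<sigma> n \<in> U)))"

lemma openin_sequential_topology:
  "openin (sequential_topology X) U \<longleftrightarrow> U \<subseteq> topspace X \<and>
     (\<forall>\<sigma> x. x \<in> U \<and> (\<forall>n. \<sigma> n \<in> topspace X) \<and> limitin X \<sigma> x sequentially \<longrightarrow>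
        (\<forall>\<^sub>F n in sequentially. \<sigma> n \<in> U))"
proof -
  have "istopology (\<lambda>U. U \<subseteq> topspace X \<and>
     (\<forall>\<sigma> x. x \<in> U \<and> (\<forall>n. \<sigma> n \<in> topspace X) \<and> limitin X \<sigma> x sequentially \<longrightarrow>
        (\<forall>\<^sub>F n in sequentially. \<sigma> n \<in> U)))" (is "istopology ?P")
    unfolding istopology_def
  proof (rule conjI; intro allI impI)
    fix S T assume ST: "?P S" "?P T"
    show "?P (S \<inter> T)"
    proof (intro conjI allI impI)
      show "S \<inter> T \<subseteq> topspace X" using ST(1) by blast
      fix \<sigma> :: "nat \<Rightarrow> 'a" and x
      assume x: "x \<in> S \<inter> T \<and> (\<forall>n. \<sigma> n \<in> topspace X) \<and> limitin X \<sigma> x sequentially"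
      have "\<forall>\<^sub>F n in sequentially. \<sigma> n \<in> S" "\<forall>\<^sub>F n in sequentially. \<sigma> n \<in> T"
        using conjunct2[OF ST(1)] conjunct2[OF ST(2)] x by blast+
      then show "\<forall>\<^sub>F n in sequentially. \<sigma> n \<in> S \<inter> T"
        by eventually_elim blast
    qed
  next
    fix \<K> assume K: "\<forall>K\<in>\<K>. ?P K"
    show "?P (\<Union>\<K>)"
    proof (intro conjI allI impI)
      show "\<Union>\<K> \<subseteq> topspace X" using K by blast
      fix \<sigma> :: "nat \<Rightarrow> 'a" and x
      assume x: "x \<in> \<Union>\<K> \<and> (\<forall>n. \<sigma> n \<in> topspace X) \<and> limitin X \<sigma> x sequentially"
      then obtain S where "S \<in> \<K>" "x \<in> S" by blast
      then have "\<forall>\<^sub>F n in sequentially. \<sigma> n \<in> S" using K x by blast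
      then show "\<forall>\<^sub>F n in sequentially. \<sigma> n \<in> \<Union>\<K>"
        by (rule eventually_mono) (use \<open>S \<in> \<K>\<close> in blast)
    qed
  qed
  then show ?thesis by (simp add: sequential_topology_def)
qed

lemma openin_imp_sequential: "openin X U \<Longrightarrow> openin (sequential_topology X) U"
  unfolding openin_sequential_topology limitin_def using openin_subset by blast

lemma topspace_sequential_topology [simp]: "topspace (sequential_topology X) = topspace X"
proof
  show "topspace (sequential_topology X) \<subseteq> topspace X"
    using openin_topspace[of "sequential_topology X"] unfolding openin_sequential_topology by blast
  show "topspace X \<subseteq> topspace (sequential_topology X)"
    using openin_subset[OF openin_imp_sequential[OF openin_topspace]] .
qed

lemma openin_sequential_topologyD:
  assumes "openin (sequential_topology X) U" "x \<in> U" "\<And>n. \<sigma> n \<in> topspace X" "limitin X \<sigma> x sequentially"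
  shows "\<forall>\<^sub>F n in sequentially. \<sigma> n \<in> U"
  using assms unfolding openin_sequential_topology by blast

lemma openin_sequential_topologyI:
  assumes "U \<subseteq> topspace X"
    and "\<And>\<sigma> x. x \<in> U \<Longrightarrow> (\<And>n. \<sigma> n \<in> topspace X) \<Longrightarrow> limitin X \<sigma> x sequentially \<Longrightarrow>
      \<forall>\<^sub>F n in sequentially. \<sigma> n \<in> U"
  shows "openin (sequential_topology X) U"
  using assms unfolding openin_sequential_topology by blast

lemma limitin_sequential_topology:
  assumes "limitin X \<sigma> x sequentially" "\<And>n. \<sigma> n \<in> topspace X"
  shows "limitin (sequential_topology X) \<sigma> x sequentially"
  unfolding limitin_def
  using limitin_topspace[OF assms(1)] openin_sequential_topologyD[of X _ x \<sigma>] assms by simp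

section \<open>Spaces without sequential fans\<close>

context rectifiable_k_network_space
begin

text \<open>Points chosen from the successive \<open>W n\<close> converge to \<open>e\<close>
  already in \<open>X\<close>, because every neighbourhood of \<open>e\<close> contains some
  \<open>\<Union>(G i)\<close>. A set around \<open>e\<close> that is open in the coreflection would
  catch such a sequence, so it contains almost all \<open>W n\<close>.\<close>

lemma sequential_base_e:
  assumes no: "\<And>s. \<not> semifan s"
  obtains W :: "nat \<Rightarrow> 'a set" where "\<And>n. openin (sequential_topology X) (W n)" "\<And>n. e \<in> W n"
    "\<And>U. openin (sequential_topology X) U \<Longrightarrow> e \<in> U \<Longrightarrow> \<exists>n. \<forall>m\<ge>n. W m \<subseteq> U"
proof -
  define good where "good F \<longleftrightarrow> finite F \<and> F \<subseteq> {A \<in> (\<Union>i. N i). e \<in> A} \<and>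
    e \<notin> seqcl (topspace X - \<Union>F)" for F
  have small: "\<exists>F. good F \<and> \<Union>F \<subseteq> U" if U: "openin X U" "e \<in> U" for U
  proof -
    from seq_neighbourhood[OF no U] obtain F where "finite F" "F \<subseteq> {A \<in> (\<Union>i. N i). e \<in> A}"
      "\<Union>F \<subseteq> U" "e \<notin> seqcl (topspace X - \<Union>F)"
      by (elim exE conjE)
    then show ?thesis unfolding good_def by (intro exI conjI)
  qed
  have cnt: "countable {F. good F}"
  proof -
    have "{F. good F} \<subseteq> {F. finite F \<and> F \<subseteq> {A \<in> (\<Union>i. N i). e \<in> A}}"
      unfolding good_def by blast
    then show ?thesis
      by (rule countable_subset[OF _ countable_Collect_finite_subset[OF point_countable[OF e]]])
  qed
  have ne: "{F. good F} \<noteq> {}" using small[OF openin_topspace e] by auto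
  define G where "G = from_nat_into {F. good F}"
  have G: "good (G n)" for n using from_nat_into[OF ne] unfolding G_def by blast
  \<comment> \<open>The sequential interior of \<open>\<Union>(G i)\<close>; idempotence of
    \<open>seqcl\<close> makes it open in the coreflection.\<close>
  define O' where "O' i = topspace X - seqcl (topspace X - \<Union>(G i))" for i
  have opnO: "openin (sequential_topology X) (O' i)" for i
  proof (rule openin_sequential_topologyI)
    show "O' i \<subseteq> topspace X" by (auto simp: O'_def)
    fix \<sigma> :: "nat \<Rightarrow> 'a" and x
    assume x: "x \<in> O' i" and sX: "\<And>n. \<sigma> n \<in> topspace X" and lim: "limitin X \<sigma> x sequentially"
    show "\<forall>\<^sub>F n in sequentially. \<sigma> n \<in> O' i"
    proof (rule ccontr)
      assume "\<not> (\<forall>\<^sub>F n in sequentially. \<sigma> n \<in> O' i)"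
      then have "infinite {n. \<sigma> n \<in> seqcl (topspace X - \<Union>(G i))}"
        using sX by (auto simp: O'_def eventually_sequentially infinite_nat_iff_unbounded_le)
      then obtain r :: "nat \<Rightarrow> nat" where r: "strict_mono r"
        "\<And>n. \<sigma> (r n) \<in> seqcl (topspace X - \<Union>(G i))"
        using infinite_sets_strict_mono_selection[of "\<lambda>_. {n. \<sigma> n \<in> seqcl (topspace X - \<Union>(G i))}"] by auto
      have "x \<in> seqcl (topspace X - \<Union>(G i))"
        by (rule seqcl_idem[OF no _ _ limitin_subsequence[OF r(1) lim]]) (use r(2) in auto)
      then show False using x by (simp add: O'_def)
    qed
  qed
  have O'_G: "O' i \<subseteq> \<Union>(G i)" for i
    using seqcl_subset[of "topspace X - \<Union>(G i)"] by (auto simp: O'_def)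
  have eO: "e \<in> O' i" for i
    using G[of i] e by (simp add: O'_def good_def)
  define W where "W n = (\<Inter>i\<le>n. O' i)" for n
  have W_O: "W n \<subseteq> O' i" if "i \<le> n" for i n using that by (auto simp: W_def)
  show ?thesis
  proof (rule that[of W])
    show "openin (sequential_topology X) (W n)" for n
      unfolding W_def using opnO by (intro openin_Inter) auto
    show "e \<in> W n" for n using eO by (simp add: W_def)
    fix U assume U: "openin (sequential_topology X) U" "e \<in> U"
    show "\<exists>n. \<forall>m\<ge>n. W m \<subseteq> U"
    proof (rule ccontr)
      assume neg: "\<not> (\<exists>n. \<forall>m\<ge>n. W m \<subseteq> U)"
      have "\<exists>y. y \<in> W n \<and> y \<notin> U" for n
      proof -
        obtain m where "m \<ge> n" "\<not> W m \<subseteq> U" using neg by blast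
        moreover have "W m \<subseteq> W n" using \<open>m \<ge> n\<close> by (auto simp: W_def)
        ultimately show ?thesis by blast
      qed
      then obtain y where y: "\<And>n. y n \<in> W n" "\<And>n. y n \<notin> U" by metis
      have yX: "y n \<in> topspace X" for n using y(1)[of n] W_O[of n n] by (auto simp: O'_def)
      have "limitin X y e sequentially"
        unfolding limitin_sequentially
      proof (intro conjI allI impI e)
        fix T assume "openin X T \<and> e \<in> T"
        then obtain F where F: "good F" "\<Union>F \<subseteq> T" using small by metis
        then obtain i where i: "G i = F"
          using from_nat_into_surj[OF cnt, of F] unfolding G_def by auto
        have "y n \<in> T" if "n \<ge> i" for n
          using y(1)[of n] W_O[OF that] O'_G[of i] F(2) i by blast
        then show "\<exists>k. \<forall>n\<ge>k. y n \<in> T" by blast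
      qed
      then have "\<forall>\<^sub>F n in sequentially. y n \<in> U"
        by (rule openin_sequential_topologyD[OF U yX])
      then show False using y(2) by simp
    qed
  qed
qed

lemma no_semifan_metrizable:
  assumes no: "\<And>s. \<not> semifan s"
  shows "metrizable_space X"
proof -
  let ?S = "sequential_topology X"
  obtain W :: "nat \<Rightarrow> 'a set" where opnW: "\<And>n. openin ?S (W n)" and eW: "\<And>n. e \<in> W n"
    and baseW: "\<And>U. openin ?S U \<Longrightarrow> e \<in> U \<Longrightarrow> \<exists>n. \<forall>m\<ge>n. W m \<subseteq> U"
    by (rule sequential_base_e[OF no]) (rule that)
  have W_lim: "limitin X w e sequentially" if w: "\<And>n. w n \<in> W n" for w
    unfolding limitin_sequentially
  proof (intro conjI allI impI e)
    fix U assume "openin X U \<and> e \<in> U"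
    then obtain n where "\<forall>m\<ge>n. W m \<subseteq> U" using baseW openin_imp_sequential by metis
    then show "\<exists>n. \<forall>m\<ge>n. w m \<in> U" using w by blast
  qed
  \<comment> \<open>Closeness measured by division: \<open>y n\<close> is \<open>mul (v n)\<close>
    of a quotient tending to \<open>e\<close>, so it shares the limit of \<open>v n\<close>. The
    points \<open>v n\<close> may vary, which is what Frink's condition needs.\<close>
  have near: "limitin X y x sequentially"
    if "limitin X v x sequentially" "\<And>n. v n \<in> topspace X" "\<And>n. y n \<in> topspace X"
      "\<And>n. dv (v n) (y n) \<in> W n" for v y x
  proof -
    have "limitin X (\<lambda>n. mul (v n) (dv (v n) (y n))) (mul x e) sequentially"
      by (rule mul_limit[OF that(1) W_lim]) (rule that(4))
    then show ?thesis using that mul_e[OF limitin_topspace[OF that(1)]] by (simp add: mul_dv)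
  qed
  \<comment> \<open>Requiring both quotients makes the relation symmetric, so that
    \<open>near\<close> can be used from a point of \<open>U k y\<close> to \<open>y\<close> as well
    as from \<open>y\<close> to the point.\<close>
  define U where "U n x = {y \<in> topspace X. dv x y \<in> W n \<and> dv y x \<in> W n}" for n x
  have U_ev: "\<forall>\<^sub>F k in sequentially. \<sigma> k \<in> U n x"
    if x: "x \<in> topspace X" and y: "y \<in> U n x" and sX: "\<And>k. \<sigma> k \<in> topspace X"
      and lim: "limitin X \<sigma> y sequentially" for \<sigma> n x y
  proof -
    have xl: "limitin X (\<lambda>_. x) x sequentially" using x by simp
    have "\<forall>\<^sub>F k in sequentially. dv x (\<sigma> k) \<in> W n"
      by (rule openin_sequential_topologyD[OF opnW _ _ dv_limit[OF xl lim]])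
        (use y x sX dv_in in \<open>auto simp: U_def\<close>)
    moreover have "\<forall>\<^sub>F k in sequentially. dv (\<sigma> k) x \<in> W n"
      by (rule openin_sequential_topologyD[OF opnW _ _ dv_limit[OF lim xl]])
        (use y x sX dv_in in \<open>auto simp: U_def\<close>)
    ultimately show ?thesis
      by eventually_elim (use sX in \<open>simp add: U_def\<close>)
  qed
  have U_self: "x \<in> U n x" if "x \<in> topspace X" for n x
    using that eW by (simp add: U_def dv_same)
  have met: "metrizable_space ?S"
  proof (rule metrizable_space_Frink[of ?S U])
    show "t1_space ?S"
      using t1 openin_imp_sequential unfolding t1_space_def topspace_sequential_topology by metis
    show "openin ?S (U n x) \<and> x \<in> U n x" if "x \<in> topspace ?S" for n x
    proof
      show "openin ?S (U n x)"
      proof (rule openin_sequential_topologyI)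
        show "U n x \<subseteq> topspace X" by (auto simp: U_def)
      qed (use U_ev that in auto)
      show "x \<in> U n x" using U_self that by simp
    qed
    show "\<exists>n. U n x \<subseteq> T" if T: "openin ?S T" "x \<in> T" for T x
    proof (rule ccontr)
      have x: "x \<in> topspace X" using openin_subset[OF T(1)] T(2) by auto
      assume "\<nexists>n. U n x \<subseteq> T"
      then have "\<forall>n. \<exists>u. u \<in> U n x \<and> u \<notin> T" by blast
      then obtain u where u: "\<And>n. u n \<in> U n x" "\<And>n. u n \<notin> T" by metis
      have uX: "u n \<in> topspace X" for n using u(1)[of n] by (simp add: U_def)
      have "limitin X u x sequentially"
        by (rule near[of "\<lambda>_. x"]) (use u(1) x in \<open>auto simp: U_def\<close>)
      then have "\<forall>\<^sub>F n in sequentially. u n \<in> T"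
        by (rule openin_sequential_topologyD[OF T uX])
      then show False using u(2) by simp
    qed
    show "\<exists>k. \<forall>y\<in>topspace ?S. U k x \<inter> U k y \<noteq> {} \<longrightarrow> U k y \<subseteq> U n x" if "x \<in> topspace ?S" for n x
    proof (rule ccontr)
      have x: "x \<in> topspace X" using that by simp
      assume "\<nexists>k. \<forall>y\<in>topspace ?S. U k x \<inter> U k y \<noteq> {} \<longrightarrow> U k y \<subseteq> U n x"
      then have "\<forall>k. \<exists>y v u. y \<in> topspace X \<and> v \<in> U k x \<and> v \<in> U k y \<and> u \<in> U k y \<and> u \<notin> U n x"
        by (simp, blast)
      then obtain y v u where *: "\<And>k. y k \<in> topspace X" "\<And>k. v k \<in> U k x" "\<And>k. v k \<in> U k (y k)"
        "\<And>k. u k \<in> U k (y k)" "\<And>k. u k \<notin> U n x"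
        by metis
      have X: "v k \<in> topspace X" "u k \<in> topspace X" for k
        using *(2,4)[of k] by (auto simp: U_def)
      \<comment> \<open>A failure of the condition gives \<open>W k\<close>-small steps from
        \<open>x\<close> to \<open>v k\<close>, on to \<open>y k\<close> and on to
        \<open>u k\<close>. Each step preserves convergence to \<open>x\<close>, so
        \<open>u k\<close> cannot stay outside \<open>U n x\<close>.\<close>
      have "limitin X v x sequentially"
        by (rule near[of "\<lambda>_. x"]) (use *(2) x in \<open>auto simp: U_def\<close>)
      then have "limitin X y x sequentially"
        by (rule near) (use *(1,3) X in \<open>auto simp: U_def\<close>)
      then have "limitin X u x sequentially"
        by (rule near) (use *(1,4) X in \<open>auto simp: U_def\<close>)
      then have "\<forall>\<^sub>F k in sequentially. u k \<in> U n x"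
        by (rule U_ev[OF x U_self[OF x] X(2)])
      then show False using *(5) by simp
    qed
  qed
  \<comment> \<open>A separating function of the coreflection is sequentially continuous, hence
    continuous on \<open>X\<close>; the set where it is below 1 is an \<open>X\<close>-neighbourhood
    of \<open>x\<close> inside \<open>T\<close>.\<close>
  have "openin X T" if T: "openin ?S T" for T
  proof (subst openin_subopen, intro ballI)
    fix x assume x: "x \<in> T"
    have TX: "T \<subseteq> topspace X" using openin_subset[OF T] by simp
    have "completely_regular_space ?S" by (rule metrizable_imp_completely_regular_space[OF met])
    moreover have "closedin ?S (topspace X - T)" "x \<in> topspace ?S - (topspace X - T)"
      using T x TX by (auto simp: closedin_def Diff_Diff_Int Int_absorb1)
    ultimately obtain f :: "'a \<Rightarrow> real" where f: "continuous_map ?S (top_of_set {0..1}) f" "f x = 0"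
      "f ` (topspace X - T) \<subseteq> {1}"
      unfolding completely_regular_space_def by meson
    have fS: "continuous_map ?S euclideanreal f"
      using f(1) by (simp add: continuous_map_in_subtopology)
    have "continuous_map X euclideanreal f"
    proof (rule k_real_continuous_seq[OF kreal])
      fix \<sigma> :: "nat \<Rightarrow> 'a" and p
      assume "limitin X \<sigma> p sequentially" "\<And>n. \<sigma> n \<in> topspace X"
      from continuous_map_limit[OF fS limitin_sequential_topology[OF this]]
      show "(\<lambda>n. f (\<sigma> n)) \<longlonglongrightarrow> f p" by (simp add: o_def)
    qed
    then have "openin X {y \<in> topspace X. f y \<in> {..<1}}"
      by (rule openin_continuous_map_preimage) simp
    moreover have "x \<in> {y \<in> topspace X. f y \<in> {..<1}}" using x TX f(2) by auto
    moreover have "{y \<in> topspace X. f y \<in> {..<1}} \<subseteq> T" using f(3) by force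
    ultimately show "\<exists>U. openin X U \<and> x \<in> U \<and> U \<subseteq> T" by blast
  qed
  then have "X = ?S" using openin_imp_sequential by (auto simp: topology_eq)
  then show ?thesis using met by simp
qed

end

section \<open>Partitions into open pieces as topological sums\<close>

lemma homeomorphic_space_sum_partition:
  assumes opn: "\<And>i. i \<in> I \<Longrightarrow> openin X (P i)"
    and disj: "\<And>i j x. i \<in> I \<Longrightarrow> j \<in> I \<Longrightarrow> x \<in> P i \<Longrightarrow> x \<in> P j \<Longrightarrow> i = j"
    and un: "(\<Union>i\<in>I. P i) = topspace X"
  shows "X homeomorphic_space sum_topology (\<lambda>i. subtopology X (P i)) I"
proof -
  let ?Y = "\<lambda>i. subtopology X (P i)"
  have PX: "P i \<subseteq> topspace X" if "i \<in> I" for i using openin_subset[OF opn[OF that]] .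
  have ts: "topspace (sum_topology ?Y I) = Sigma I P"
    using subsetD[OF PX] by (auto simp: topspace_sum_topology)
  have "homeomorphic_map (sum_topology ?Y I) X snd"
  proof (rule bijective_open_imp_homeomorphic_map)
    show "continuous_map (sum_topology ?Y I) X snd"
      unfolding continuous_map
    proof (intro conjI allI impI)
      show "snd ` topspace (sum_topology ?Y I) \<subseteq> topspace X"
        using subsetD[OF PX] unfolding ts by auto
      fix U assume U: "openin X U"
      have "{p \<in> topspace (sum_topology ?Y I). snd p \<in> U} = Sigma I (\<lambda>i. P i \<inter> U)"
        unfolding ts by auto
      moreover have "openin (sum_topology ?Y I) (Sigma I (\<lambda>i. P i \<inter> U))"
        unfolding openin_disjoint_union using U by (simp add: openin_subtopology_Int2)
      ultimately show "openin (sum_topology ?Y I) {p \<in> topspace (sum_topology ?Y I). snd p \<in> U}" by simp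
    qed
    show "open_map (sum_topology ?Y I) X snd"
      unfolding open_map_def
    proof (intro allI impI)
      fix U assume "openin (sum_topology ?Y I) U"
      then obtain T where T: "U = Sigma I T" "\<forall>i\<in>I. openin (?Y i) (T i)"
        unfolding openin_sum_topology_alt by blast
      have "snd ` U = (\<Union>i\<in>I. T i)" unfolding T(1) by force
      moreover have "openin X (T i)" if "i \<in> I" for i
        using T(2) opn that openin_trans_full by blast
      ultimately show "openin X (snd ` U)" by auto
    qed
    show "snd ` topspace (sum_topology ?Y I) = topspace X"
      unfolding ts un[symmetric] by force
    show "inj_on snd (topspace (sum_topology ?Y I))"
      unfolding ts using disj by (auto simp: inj_on_def)
  qed
  then show ?thesis
    using homeomorphic_map_imp_homeomorphic_space homeomorphic_space_sym by blast
qed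

section \<open>Spaces without metric fans\<close>

text \<open>Here every convergent sequence is trapped by finitely many compact members of the network. Such
  members are linked when they meet; the chain classes of points are clopen, because membership in
  a class is sequentially continuous, and each is covered by countably many compact members.\<close>

locale compact_k_network_space = k_network_space +
  assumes kreal: "k_real_space X"
    and cover: "\<And>\<sigma> x. limitin X \<sigma> x sequentially \<Longrightarrow>
      \<exists>F. finite F \<and> F \<subseteq> (\<Union>i. N i) \<and> (\<forall>A\<in>F. x \<in> A \<and> compactin X A) \<and>
        (\<forall>\<^sub>F n in sequentially. \<sigma> n \<in> \<Union>F)"
begin

definition CN :: "'a set set" where "CN = {A \<in> (\<Union>i. N i). compactin X A}"

definition linked :: "'a rel" where "linked = {(x,y). \<exists>A\<in>CN. x \<in> A \<and> y \<in> A}"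

definition cls :: "'a \<Rightarrow> 'a set" where "cls x = linked\<^sup>* `` {x}"

lemma cls_eq: "y \<in> cls x \<Longrightarrow> cls y = cls x"
proof -
  have "sym linked" unfolding linked_def sym_def by blast
  then have "sym (linked\<^sup>*)" by (rule sym_rtrancl)
  moreover assume "y \<in> cls x"
  ultimately have "(x,y) \<in> linked\<^sup>*" "(y,x) \<in> linked\<^sup>*"
    unfolding cls_def by (auto dest: symD)
  then show ?thesis unfolding cls_def by (auto intro: rtrancl_trans)
qed

lemma cls_self: "x \<in> cls x"
  by (simp add: cls_def)

lemma CN_compact: "A \<in> CN \<Longrightarrow> compactin X A"
  by (simp add: CN_def)

lemma CN_cls: "A \<in> CN \<Longrightarrow> y \<in> A \<Longrightarrow> y \<in> cls x \<Longrightarrow> A \<subseteq> cls x"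
  unfolding cls_def linked_def by (auto intro: rtrancl_into_rtrancl)

lemma cls_topspace: "x \<in> topspace X \<Longrightarrow> cls x \<subseteq> topspace X"
proof
  fix y assume "x \<in> topspace X" "y \<in> cls x"
  then have "(x,y) \<in> linked\<^sup>*" by (simp add: cls_def)
  then show "y \<in> topspace X"
  proof (cases rule: rtranclE)
    case base
    then show ?thesis using \<open>x \<in> topspace X\<close> by simp
  next
    case (step z)
    then show ?thesis using compactin_subset_topspace[OF CN_compact] unfolding linked_def by blast
  qed
qed

lemma CN_cover:
  assumes "limitin X \<sigma> x sequentially"
  obtains F where "finite F" "F \<subseteq> CN" "\<And>A. A \<in> F \<Longrightarrow> x \<in> A" "\<forall>\<^sub>F n in sequentially. \<sigma> n \<in> \<Union>F"
proof -
  from cover[OF assms] obtain F where "finite F" "F \<subseteq> (\<Union>i. N i)"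
    "\<forall>A\<in>F. x \<in> A \<and> compactin X A" "\<forall>\<^sub>F n in sequentially. \<sigma> n \<in> \<Union>F"
    by (elim exE conjE)
  then show ?thesis using that[of F] unfolding CN_def by auto
qed

lemma in_CN: "x \<in> topspace X \<Longrightarrow> \<exists>A\<in>CN. x \<in> A"
proof -
  assume "x \<in> topspace X"
  then have "limitin X (\<lambda>_::nat. x) x sequentially" by simp
  from CN_cover[OF this] obtain F where "F \<subseteq> CN" "\<forall>\<^sub>F n::nat in sequentially. x \<in> \<Union>F"
    by metis
  then show ?thesis by auto
qed

text \<open>The trapping members all contain \<open>x\<close>, so their points are linked to
  \<open>x\<close> in one step.\<close>

lemma eventually_cls:
  assumes "limitin X \<sigma> x sequentially"
  shows "\<forall>\<^sub>F n in sequentially. cls (\<sigma> n) = cls x"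
proof -
  obtain F where F: "finite F" "F \<subseteq> CN" "\<And>A. A \<in> F \<Longrightarrow> x \<in> A" "\<forall>\<^sub>F n in sequentially. \<sigma> n \<in> \<Union>F"
    using CN_cover[OF assms] by metis
  show ?thesis
  proof (rule eventually_mono[OF F(4)])
    fix n assume "\<sigma> n \<in> \<Union>F"
    then obtain A where "A \<in> F" "\<sigma> n \<in> A" by (rule UnionE)
    then have "\<sigma> n \<in> cls x" using CN_cls[of A x x] F(2,3) cls_self by blast
    then show "cls (\<sigma> n) = cls x" by (rule cls_eq)
  qed
qed

lemma openin_cls_Collect: "openin X {y \<in> topspace X. Q (cls y)}"
proof -
  \<comment> \<open>An indicator stands in for the set, since \<open>kreal\<close> speaks of
    functions only; it is eventually constant along convergent sequences.\<close>
  define f :: "'a \<Rightarrow> real" where "f y = (if Q (cls y) then 1 else 0)" for y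
  have "continuous_map X euclideanreal f"
  proof (rule k_real_continuous_seq[OF kreal])
    fix \<sigma> x assume "limitin X \<sigma> x sequentially"
    from eventually_cls[OF this] have "\<forall>\<^sub>F n in sequentially. f (\<sigma> n) = f x"
      by (rule eventually_mono) (simp add: f_def)
    then show "(\<lambda>n. f (\<sigma> n)) \<longlonglongrightarrow> f x" by (rule tendsto_eventually)
  qed
  then have "openin X {y \<in> topspace X. f y \<in> {0<..}}"
    by (rule openin_continuous_map_preimage) simp
  moreover have "{y \<in> topspace X. f y \<in> {0<..}} = {y \<in> topspace X. Q (cls y)}"
    by (auto simp: f_def)
  ultimately show ?thesis by simp
qed

lemma cls_Collect: "x \<in> topspace X \<Longrightarrow> cls x = {y \<in> topspace X. cls y = cls x}"
  using cls_topspace cls_eq cls_self by blast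

lemma openin_cls: "x \<in> topspace X \<Longrightarrow> openin X (cls x)"
  using openin_cls_Collect[of "\<lambda>S. S = cls x"] cls_Collect by simp

text \<open>A compact set meets only countably many members of the network, so countability survives
  each lengthening of the chains by one link.\<close>

lemma countable_CN_cls:
  assumes x: "x \<in> topspace X"
  shows "countable {A \<in> CN. A \<inter> cls x \<noteq> {}}"
proof -
  define S where "S n = {A \<in> CN. A \<inter> (linked ^^ n) `` {x} \<noteq> {}}" for n
  have "countable (S n)" for n
  proof (induction n)
    case 0
    have "S 0 \<subseteq> {A \<in> (\<Union>i. N i). x \<in> A}" by (auto simp: S_def CN_def)
    then show ?case using point_countable[OF x] by (rule countable_subset)
  next
    case (Suc n)
    have "S (Suc n) \<subseteq> (\<Union>A\<in>S n. {A' \<in> (\<Union>i. N i). A' \<inter> A \<noteq> {}})"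
    proof
      fix A' assume A': "A' \<in> S (Suc n)"
      then obtain z where "z \<in> A'" "(x,z) \<in> linked ^^ Suc n" by (auto simp: S_def)
      moreover then obtain y where "(x,y) \<in> linked ^^ n" "(y,z) \<in> linked" by auto
      moreover then obtain A where "A \<in> CN" "y \<in> A" "z \<in> A" by (auto simp: linked_def)
      ultimately show "A' \<in> (\<Union>A\<in>S n. {A' \<in> (\<Union>i. N i). A' \<inter> A \<noteq> {}})"
        using A' by (intro UN_I[of A]) (auto simp: S_def CN_def)
    qed
    moreover have "countable (\<Union>A\<in>S n. {A' \<in> (\<Union>i. N i). A' \<inter> A \<noteq> {}})"
      using Suc compact_countable CN_compact by (intro countable_UN) (auto simp: S_def)
    ultimately show ?case by (rule countable_subset)
  qed
  then have "countable (\<Union>n. S n)" by (intro countable_UN) auto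
  moreover have "{A \<in> CN. A \<inter> cls x \<noteq> {}} \<subseteq> (\<Union>n. S n)"
    unfolding S_def cls_def rtrancl_is_UN_relpow by blast
  ultimately show ?thesis by (rule countable_subset[rotated])
qed

lemma cosmic_cls:
  assumes x: "x \<in> topspace X"
  shows "cosmic_space (subtopology X (cls x))"
  unfolding cosmic_space_def regular_t1_space_def
proof (intro conjI exI)
  show "regular_space (subtopology X (cls x))" "t1_space (subtopology X (cls x))"
    using reg t1 by (simp_all add: regular_space_subtopology t1_space_subtopology)
  \<comment> \<open>A nonempty member inside the class meets one of the countably many compact
    members covering the class, and each of those meets countably many members.\<close>
  define P where "P = {A \<in> (\<Union>i. N i). A \<noteq> {} \<and> A \<subseteq> cls x}"
  have "P \<subseteq> (\<Union>B\<in>{A \<in> CN. A \<inter> cls x \<noteq> {}}. {A \<in> (\<Union>i. N i). A \<inter> B \<noteq> {}})"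
  proof
    fix A assume A: "A \<in> P"
    then obtain y where y: "y \<in> A" "y \<in> cls x" by (auto simp: P_def)
    then obtain B where B: "B \<in> CN" "y \<in> B" using in_CN cls_topspace[OF x] by blast
    show "A \<in> (\<Union>B\<in>{A \<in> CN. A \<inter> cls x \<noteq> {}}. {A \<in> (\<Union>i. N i). A \<inter> B \<noteq> {}})"
      using A y B by (intro UN_I[of B]) (auto simp: P_def)
  qed
  moreover have "countable (\<Union>B\<in>{A \<in> CN. A \<inter> cls x \<noteq> {}}. {A \<in> (\<Union>i. N i). A \<inter> B \<noteq> {}})"
    using countable_CN_cls[OF x] compact_countable CN_compact by (intro countable_UN) auto
  ultimately show "countable P" by (rule countable_subset)
  show "network_in (subtopology X (cls x)) P"
    unfolding network_in_def
  proof (intro conjI allI impI)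
    show "\<Union>P \<subseteq> topspace (subtopology X (cls x))"
      using cls_topspace[OF x] by (auto simp: P_def)
    fix y U assume U: "openin (subtopology X (cls x)) U \<and> y \<in> U"
    then have "openin X U" "U \<subseteq> cls x"
      using openin_cls[OF x] by (simp_all add: openin_open_subtopology)
    with U obtain i A where "A \<in> N i" "y \<in> A" "A \<subseteq> U" using knet_point by metis
    then show "\<exists>N\<in>P. y \<in> N \<and> N \<subseteq> U"
      using \<open>U \<subseteq> cls x\<close> by (intro bexI[of _ A]) (auto simp: P_def)
  qed
qed

text \<open>One step of the exhaustion. On the closed set
  \<open>L \<union> (insert p F \<inter> K)\<close>, the function built so far is glued with the
  values 0 at \<open>p\<close> and 1 on \<open>F\<close>, and Tietze's theorem extends the result
  over the compact Hausdorff, hence normal, \<open>K\<close>.\<close>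

lemma compact_extension:
  fixes f \<phi> :: "'a \<Rightarrow> real"
  assumes K: "compactin X K" and L: "compactin X L" "L \<subseteq> K"
    and f: "continuous_map (subtopology X L) euclideanreal f"
    and F: "closedin X (F \<inter> K)" and p: "p \<in> topspace X" and pF: "p \<notin> F"
    and \<phi>: "\<And>y. \<phi> y = (if y = p then 0 else 1)"
    and agree: "\<And>y. y \<in> insert p F \<inter> L \<Longrightarrow> f y = \<phi> y"
  shows "\<exists>g. (continuous_map (subtopology X K) euclideanreal g \<and> (\<forall>y\<in>insert p F \<inter> K. g y = \<phi> y)) \<and>
    (\<forall>y\<in>L. g y = f y)"
proof -
  define M where "M = L \<union> (insert p F \<inter> K)"
  define h where "h y = (if y \<in> L then f y else \<phi> y)" for y
  have KX: "K \<subseteq> topspace X" by (rule compactin_subset_topspace[OF K])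
  have cloK: "closedin X K" and cloL: "closedin X L"
    using compactin_imp_closedin[OF Hausdorff] K L by blast+
  have clop: "closedin X {p}" by (rule closedin_t1_singleton[OF t1 p])
  have cloF: "closedin X (insert p F \<inter> K)"
  proof -
    have "insert p F \<inter> K = ({p} \<inter> K) \<union> (F \<inter> K)" by blast
    then show ?thesis using closedin_Un[OF closedin_Int[OF clop cloK] F] by simp
  qed
  have MK: "M \<subseteq> K" using L(2) by (auto simp: M_def)
  have "closedin X M" unfolding M_def by (rule closedin_Un[OF cloL cloF])
  then have cloM: "closedin (subtopology X K) M" using MK by (rule closedin_subset_topspace)
  have "continuous_map (subtopology X M) euclideanreal h"
    unfolding continuous_map_closedin
  proof (intro conjI allI impI ballI)
    fix C assume C: "closedin euclideanreal C"
    have 1: "closedin X {y \<in> L. f y \<in> C}"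
    proof -
      have "closedin (subtopology X L) {y \<in> topspace (subtopology X L). f y \<in> C}"
        by (rule closedin_continuous_map_preimage[OF f C])
      moreover have "{y \<in> topspace (subtopology X L). f y \<in> C} = {y \<in> L. f y \<in> C}"
        using L(2) KX by auto
      ultimately show ?thesis using closedin_trans_full[OF _ cloL] by simp
    qed
    have 2: "closedin X {y \<in> insert p F \<inter> K. \<phi> y \<in> C}"
    proof -
      have "{y \<in> insert p F \<inter> K. \<phi> y \<in> C} =
          (if 0 \<in> C then {p} \<inter> K else {}) \<union> (if 1 \<in> C then F \<inter> K else {})"
        using pF by (auto simp: \<phi>)
      then show ?thesis using F clop cloK by (auto intro!: closedin_Un closedin_Int)
    qed
    have "{y \<in> topspace (subtopology X M). h y \<in> C} = {y \<in> L. f y \<in> C} \<union> {y \<in> insert p F \<inter> K. \<phi> y \<in> C}"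
      using agree L(2) KX by (auto simp: h_def M_def)
    then have "closedin X {y \<in> topspace (subtopology X M). h y \<in> C}"
      using closedin_Un[OF 1 2] by simp
    then show "closedin (subtopology X M) {y \<in> topspace (subtopology X M). h y \<in> C}"
      by (rule closedin_subset_topspace) auto
  qed simp
  then have "continuous_map (subtopology (subtopology X K) M) euclideanreal h"
    using MK by (simp add: subtopology_subtopology Int_absorb1)
  moreover have "normal_space (subtopology X K)"
    using K Hausdorff
    by (intro compact_Hausdorff_or_regular_imp_normal_space)
      (auto simp: compact_space_subtopology Hausdorff_space_subtopology)
  ultimately obtain g where g: "continuous_map (subtopology X K) euclideanreal g"
    "\<And>y. y \<in> M \<Longrightarrow> g y = h y"
    using Tietze_extension_realinterval[of "subtopology X K" M UNIV h] cloM by auto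
  show ?thesis
  proof (intro exI conjI ballI)
    show "continuous_map (subtopology X K) euclideanreal g" by (rule g(1))
    show "g y = \<phi> y" if "y \<in> insert p F \<inter> K" for y
      using that g(2)[of y] agree[of y] by (auto simp: M_def h_def)
    show "g y = f y" if "y \<in> L" for y
      using that g(2)[of y] by (auto simp: M_def h_def)
  qed
qed

text \<open>Urysohn functions on the classes are built along an exhaustion by compact sets; being
  sequentially continuous, they are continuous.\<close>

lemma k_omega_closed:
  assumes x: "x \<in> topspace X" and F: "F \<subseteq> cls x"
    and FA: "\<And>A. A \<in> CN \<Longrightarrow> A \<inter> cls x \<noteq> {} \<Longrightarrow> closedin X (F \<inter> A)"
    and p: "p \<in> cls x" "p \<notin> F"
  shows "\<exists>U. openin X U \<and> p \<in> U \<and> U \<inter> F = {}"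
proof -
  define P where "P = {A \<in> CN. A \<inter> cls x \<noteq> {}}"
  have pX: "p \<in> topspace X" using p(1) cls_topspace[OF x] by blast
  have cP: "countable P" unfolding P_def by (rule countable_CN_cls[OF x])
  obtain A0 where "A0 \<in> CN" "p \<in> A0" using in_CN[OF pX] by blast
  then have neP: "P \<noteq> {}" using p(1) by (auto simp: P_def)
  define k where "k = from_nat_into P"
  have k: "k n \<in> P" for n using from_nat_into[OF neP] by (simp add: k_def)
  define M where "M n = (\<Union>i<n. k i)" for n
  have Mmono: "M m \<subseteq> M n" if "m \<le> n" for m n
    using that unfolding M_def by (intro UN_mono) auto
  have Mcomp: "compactin X (M n)" for n
    unfolding M_def using k CN_compact by (intro compactin_Union) (auto simp: P_def)
  have MF: "closedin X (F \<inter> M n)" for n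
  proof -
    have "F \<inter> M n = (\<Union>i<n. F \<inter> k i)" by (auto simp: M_def)
    moreover have "closedin X (\<Union>i<n. F \<inter> k i)"
      using FA k by (intro closedin_Union) (auto simp: P_def)
    ultimately show ?thesis by simp
  qed
  define \<phi> :: "'a \<Rightarrow> real" where "\<phi> y = (if y = p then 0 else 1)" for y
  define Q where "Q n g \<longleftrightarrow> continuous_map (subtopology X (M n)) euclideanreal g \<and>
    (\<forall>y\<in>insert p F \<inter> M n. g y = \<phi> y)" for n g
  have "\<exists>g. \<forall>n. Q n (g n) \<and> (\<forall>y\<in>M n. g (Suc n) y = g n y)"
  proof (rule dependent_nat_choice)
    \<comment> \<open>\<open>M 0\<close> is empty, so any function starts the recursion.\<close>
    show "\<exists>g. Q 0 g"
    proof (intro exI)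
      show "Q 0 \<phi>" by (simp add: Q_def M_def continuous_map_on_empty)
    qed
    fix g n assume g: "Q n g"
    show "\<exists>g'. Q (Suc n) g' \<and> (\<forall>y\<in>M n. g' y = g y)"
      unfolding Q_def
    proof (rule compact_extension[OF Mcomp Mcomp Mmono _ MF pX p(2)])
      show "continuous_map (subtopology X (M n)) euclideanreal g" using g by (simp add: Q_def)
      show "\<phi> y = (if y = p then 0 else 1)" for y by (simp add: \<phi>_def)
      show "g y = \<phi> y" if "y \<in> insert p F \<inter> M n" for y using g that by (simp add: Q_def)
    qed simp
  qed
  then obtain g where g: "\<And>n. Q n (g n)" "\<And>n y. y \<in> M n \<Longrightarrow> g (Suc n) y = g n y" by metis
  have gmono: "g n y = g m y" if "m \<le> n" "y \<in> M m" for m n y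
    using that
  proof (induction n rule: dec_induct)
    case (step n)
    then show ?case using g(2)[of y n] Mmono[of m n] by auto
  qed simp
  \<comment> \<open>The stages agree where they overlap, so the least stage containing
    \<open>y\<close> stands for all. The value 0 outside the class is harmless, since a convergent
    sequence is eventually in the class of its limit.\<close>
  define f where "f y = (if y \<in> cls x then g (LEAST n. y \<in> M n) y else 0)" for y
  have M_cls: "M n \<subseteq> cls x" for n
    using k CN_cls unfolding M_def P_def by blast
  have fg: "f y = g n y" if "y \<in> M n" for n y
    using gmono[OF Least_le[of "\<lambda>n. y \<in> M n", OF that] LeastI[of "\<lambda>n. y \<in> M n", OF that]] M_cls that
    by (auto simp: f_def)
  \<comment> \<open>Through this, a sequence trapped by finitely many compact members eventually
    lies in a single stage, on which \<open>f\<close> is continuous.\<close>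
  have fin_M: "\<exists>n. \<Union>G \<subseteq> M n" if G: "finite G" "G \<subseteq> P" for G
  proof -
    have "\<forall>A\<in>G. \<exists>i. k i = A" using from_nat_into_surj[OF cP] G(2) unfolding k_def by blast
    then obtain i where i: "\<And>A. A \<in> G \<Longrightarrow> k (i A) = A" by metis
    obtain n where "\<forall>A\<in>G. i A < n"
      using finite_nat_set_iff_bounded[of "i ` G"] G(1) by auto
    then have "\<Union>G \<subseteq> M n" using i unfolding M_def by blast
    then show ?thesis ..
  qed
  have "continuous_map X euclideanreal f"
  proof (rule k_real_continuous_seq[OF kreal])
    fix \<sigma> y assume lim: "limitin X \<sigma> y sequentially" and sX: "\<And>n. \<sigma> n \<in> topspace X"
    show "(\<lambda>n. f (\<sigma> n)) \<longlonglongrightarrow> f y"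
    proof (cases "y \<in> cls x")
      case False
      have "\<forall>\<^sub>F n in sequentially. f (\<sigma> n) = f y"
        using eventually_cls[OF lim]
      proof (rule eventually_mono)
        fix n assume "cls (\<sigma> n) = cls y"
        then have "\<sigma> n \<notin> cls x" using False cls_eq cls_self by metis
        then show "f (\<sigma> n) = f y" using False by (simp add: f_def)
      qed
      then show ?thesis by (rule tendsto_eventually)
    next
      case True
      obtain G where G: "finite G" "G \<subseteq> CN" "\<And>A. A \<in> G \<Longrightarrow> y \<in> A" "\<forall>\<^sub>F n in sequentially. \<sigma> n \<in> \<Union>G"
        using CN_cover[OF lim] by metis
      have "G \<subseteq> P" using G(2,3) True unfolding P_def by blast
      then obtain m where m: "\<Union>G \<subseteq> M m" using fin_M G(1) by blast
      have ev: "\<forall>\<^sub>F n in sequentially. \<sigma> n \<in> M m" using G(4) by (rule eventually_mono) (use m in blast)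
      have "G \<noteq> {}" using G(4) by auto
      then have ym: "y \<in> M m" using G(3) m by blast
      have "limitin (subtopology X (M m)) \<sigma> y sequentially"
        using lim ev ym by (simp add: limitin_subtopology)
      moreover have "continuous_map (subtopology X (M m)) euclideanreal (g m)"
        using g(1) by (simp add: Q_def)
      ultimately have "(\<lambda>n. g m (\<sigma> n)) \<longlonglongrightarrow> g m y"
        using continuous_map_limit by (fastforce simp: o_def)
      moreover have "\<forall>\<^sub>F n in sequentially. g m (\<sigma> n) = f (\<sigma> n)"
        using ev by (rule eventually_mono) (simp add: fg)
      ultimately show ?thesis using fg[OF ym] by (simp add: tendsto_cong)
    qed
  qed
  then have op: "openin X {y \<in> topspace X. f y \<in> {..<1}}"
    by (rule openin_continuous_map_preimage) simp
  have f\<phi>: "f y = \<phi> y" if y: "y \<in> insert p F" for y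
  proof -
    have "y \<in> cls x" using y p(1) F by blast
    then obtain A where A: "A \<in> CN" "y \<in> A" using in_CN cls_topspace[OF x] by blast
    then have "{A} \<subseteq> P" using \<open>y \<in> cls x\<close> by (auto simp: P_def)
    then obtain n where "y \<in> M n" using fin_M[of "{A}"] A(2) by auto
    then show ?thesis using fg g(1)[of n] y by (simp add: Q_def)
  qed
  have "p \<in> {y \<in> topspace X. f y \<in> {..<1}}" using f\<phi>[of p] pX by (simp add: \<phi>_def)
  moreover have "{y \<in> topspace X. f y \<in> {..<1}} \<inter> F = {}"
    using f\<phi> p(2) by (auto simp: \<phi>_def split: if_splits)
  ultimately show ?thesis using op by blast
qed

text \<open>The compact members meeting the class serve as the cover. Closed traces on them imply
  closedness by way of the Urysohn functions of \<open>k_omega_closed\<close>.\<close>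

lemma k_omega_cls:
  assumes x: "x \<in> topspace X"
  shows "k_omega_space (subtopology X (cls x))"
  unfolding k_omega_space_def
proof (intro exI conjI ballI allI impI)
  define P where "P = {A \<in> CN. A \<inter> cls x \<noteq> {}}"
  have Psub: "A \<subseteq> cls x" if "A \<in> P" for A using that CN_cls unfolding P_def by blast
  have ts: "topspace (subtopology X (cls x)) = cls x" using cls_topspace[OF x] by auto
  show "countable P" unfolding P_def by (rule countable_CN_cls[OF x])
  show "compactin (subtopology X (cls x)) A" if "A \<in> P" for A
    using that Psub CN_compact by (auto simp: compactin_subtopology P_def)
  show "\<Union>P = topspace (subtopology X (cls x))"
    unfolding ts
  proof
    show "\<Union>P \<subseteq> cls x" using Psub by blast
    show "cls x \<subseteq> \<Union>P"
    proof
      fix y assume y: "y \<in> cls x"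
      then obtain A where "A \<in> CN" "y \<in> A" using in_CN cls_topspace[OF x] by blast
      then show "y \<in> \<Union>P" using y by (intro UnionI[of A]) (auto simp: P_def)
    qed
  qed
  fix F assume "F \<subseteq> topspace (subtopology X (cls x))"
  then have F: "F \<subseteq> cls x" by (simp add: ts)
  show "closedin (subtopology X (cls x)) F \<longleftrightarrow>
      (\<forall>K\<in>P. closedin (subtopology (subtopology X (cls x)) K) (F \<inter> K))"
  proof
    assume "closedin (subtopology X (cls x)) F"
    then show "\<forall>K\<in>P. closedin (subtopology (subtopology X (cls x)) K) (F \<inter> K)"
      unfolding closedin_subtopology[of "subtopology X (cls x)"] by blast
  next
    assume R: "\<forall>K\<in>P. closedin (subtopology (subtopology X (cls x)) K) (F \<inter> K)"
    have FA: "closedin X (F \<inter> A)" if "A \<in> CN" "A \<inter> cls x \<noteq> {}" for A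
    proof -
      have A: "A \<in> P" using that by (simp add: P_def)
      then have "closedin (subtopology X A) (F \<inter> A)"
        using bspec[OF R A] Psub[OF A] by (simp add: subtopology_subtopology Int_absorb1)
      then show ?thesis
        using closedin_trans_full compactin_imp_closedin[OF Hausdorff CN_compact[OF that(1)]] by blast
    qed
    have "openin X (cls x - F)"
    proof (subst openin_subopen, intro ballI)
      fix p assume p: "p \<in> cls x - F"
      then obtain U where U: "openin X U" "p \<in> U" "U \<inter> F = {}"
        using k_omega_closed[OF x F FA] by blast
      then show "\<exists>T. openin X T \<and> p \<in> T \<and> T \<subseteq> cls x - F"
        using p openin_cls[OF x] by (intro exI[of _ "U \<inter> cls x"]) auto
    qed
    then have "openin (subtopology X (cls x)) (cls x - F)"
      using openin_cls[OF x] by (simp add: openin_open_subtopology)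
    then show "closedin (subtopology X (cls x)) F"
      unfolding closedin_def ts using F by (intro conjI)
  qed
qed

lemma sum_of_cosmic_k_omega: "sum_of_cosmic_k_omega_spaces X"
proof -
  \<comment> \<open>The choice depends on the class alone, so points of one class get the same
    representative and each class is indexed once.\<close>
  define c where "c x = (SOME y. y \<in> cls x)" for x
  have c: "cls (c x) = cls x" for x
  proof -
    have "c x \<in> cls x" unfolding c_def by (rule someI[of _ x]) (rule cls_self)
    then show ?thesis by (rule cls_eq)
  qed
  define I where "I = c ` topspace X"
  have IX: "i \<in> topspace X" if "i \<in> I" for i
  proof -
    obtain x where "x \<in> topspace X" "i = c x" using \<open>i \<in> I\<close> by (auto simp: I_def)
    then show ?thesis using c[of x] cls_self[of i] cls_topspace[of x] by auto
  qed
  have "X homeomorphic_space sum_topology (\<lambda>i. subtopology X (cls i)) I"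
  proof (rule homeomorphic_space_sum_partition)
    show "openin X (cls i)" if "i \<in> I" for i using openin_cls[OF IX[OF that]] .
    show "i = j" if ij: "i \<in> I" "j \<in> I" "x \<in> cls i" "x \<in> cls j" for i j x
    proof -
      obtain y z where yz: "i = c y" "j = c z" using ij(1,2) by (auto simp: I_def)
      have "cls y = cls z" using cls_eq[OF ij(3)] cls_eq[OF ij(4)] c yz by simp
      then show ?thesis by (simp add: yz c_def)
    qed
    show "(\<Union>i\<in>I. cls i) = topspace X"
      using cls_topspace IX c cls_self by (fastforce simp: I_def)
  qed
  moreover have "\<forall>i\<in>I. cosmic_space (subtopology X (cls i)) \<and> k_omega_space (subtopology X (cls i))"
    using cosmic_cls k_omega_cls IX by blast
  ultimately show ?thesis unfolding sum_of_cosmic_k_omega_spaces_def by (intro exI conjI)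
qed

end

section \<open>From the rectification to the operations, and the dichotomy\<close>

text \<open>By the condition on fibres, \<open>h\<close> and its inverse preserve first coordinates,
  so their second coordinates are the division and the multiplication. Mutual inversion gives the
  cancellation laws, and the image of the diagonal gives \<open>dv x x = e\<close>.\<close>

lemma rectifiable_space_operations:
  assumes "rectifiable_space X"
  obtains e mul dv where "e \<in> topspace X"
    "continuous_map (prod_topology X X) X (\<lambda>(x,y). mul x y)"
    "continuous_map (prod_topology X X) X (\<lambda>(x,y). dv x y)"
    "\<And>x. x \<in> topspace X \<Longrightarrow> dv x x = e"
    "\<And>x y. x \<in> topspace X \<Longrightarrow> y \<in> topspace X \<Longrightarrow> mul x (dv x y) = y"
    "\<And>x y. x \<in> topspace X \<Longrightarrow> y \<in> topspace X \<Longrightarrow> dv x (mul x y) = y"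
proof -
  from assms obtain e h where e: "e \<in> topspace X"
    and hom: "homeomorphic_map (prod_topology X X) (prod_topology X X) h"
    and diag: "h ` {(x, x) |x. x \<in> topspace X} = topspace X \<times> {e}"
    and "\<forall>x\<in>topspace X. h ` ({x} \<times> topspace X) = {x} \<times> topspace X"
    unfolding rectifiable_space_def by (elim bexE exE conjE)
  then have fib: "h ` ({x} \<times> topspace X) = {x} \<times> topspace X" if "x \<in> topspace X" for x
    using that by blast
  obtain g where g: "homeomorphic_maps (prod_topology X X) (prod_topology X X) h g"
    using hom by (auto simp: homeomorphic_map_maps)
  then have hc: "continuous_map (prod_topology X X) (prod_topology X X) h"
    and gc: "continuous_map (prod_topology X X) (prod_topology X X) g"
    and gh: "\<And>p. p \<in> topspace X \<times> topspace X \<Longrightarrow> g (h p) = p"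
    and hg: "\<And>p. p \<in> topspace X \<times> topspace X \<Longrightarrow> h (g p) = p"
    unfolding homeomorphic_maps_def topspace_prod_topology by blast+
  have hf: "h (x,y) = (x, snd (h (x,y)))" if "x \<in> topspace X" "y \<in> topspace X" for x y
  proof -
    have "h (x,y) \<in> {x} \<times> topspace X" using fib[OF that(1)] that(2) by blast
    then show ?thesis by auto
  qed
  have gf: "g (x,y) = (x, snd (g (x,y)))" if "x \<in> topspace X" "y \<in> topspace X" for x y
  proof -
    have "(x,y) \<in> h ` ({x} \<times> topspace X)" using fib[OF that(1)] that(2) by blast
    then obtain z where "z \<in> topspace X" "(x,y) = h (x,z)" by blast
    then show ?thesis using gh[of "(x,z)"] that(1) by simp
  qed
  show ?thesis
  proof (rule that[of e "\<lambda>x y. snd (g (x,y))" "\<lambda>x y. snd (h (x,y))"])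
    show "continuous_map (prod_topology X X) X (\<lambda>(x, y). snd (g (x, y)))"
    proof -
      have "(\<lambda>(x, y). snd (g (x, y))) = snd \<circ> g" by auto
      then show ?thesis using continuous_map_compose[OF gc continuous_map_snd] by simp
    qed
    show "continuous_map (prod_topology X X) X (\<lambda>(x, y). snd (h (x, y)))"
    proof -
      have "(\<lambda>(x, y). snd (h (x, y))) = snd \<circ> h" by auto
      then show ?thesis using continuous_map_compose[OF hc continuous_map_snd] by simp
    qed
    show "snd (h (x, x)) = e" if "x \<in> topspace X" for x
    proof -
      have "h (x,x) \<in> topspace X \<times> {e}" using diag that by blast
      then show ?thesis by auto
    qed
    show "snd (g (x, snd (h (x, y)))) = y" if "x \<in> topspace X" "y \<in> topspace X" for x y
      using gh[of "(x,y)"] hf[OF that] that by (metis SigmaI snd_conv)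
    show "snd (h (x, snd (g (x, y)))) = y" if "x \<in> topspace X" "y \<in> topspace X" for x y
      using hg[of "(x,y)"] gf[OF that] that by (metis SigmaI snd_conv)
  qed (rule e)
qed

theorem theorem1p6:
  fixes X :: "'a topology"
  assumes "rectifiable_space X"
    and "tychonoff_space X"
    and "aleph_space X"
    and "k_real_space X"
    and "\<not> (\<exists>F. strong_Fin_fan X F)"
  shows "metrizable_space X \<or> sum_of_cosmic_k_omega_spaces X"
proof -
  obtain N where "k_network_space X N"
    using aleph_space_imp_k_network_space[OF assms(3)] by (elim exE)
  then interpret k_network_space X N .
  obtain e mul dv where ops: "e \<in> topspace X"
    "continuous_map (prod_topology X X) X (\<lambda>(x,y). mul x y)"
    "continuous_map (prod_topology X X) X (\<lambda>(x,y). dv x y)"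
    "\<And>x. x \<in> topspace X \<Longrightarrow> dv x x = e"
    "\<And>x y. x \<in> topspace X \<Longrightarrow> y \<in> topspace X \<Longrightarrow> mul x (dv x y) = y"
    "\<And>x y. x \<in> topspace X \<Longrightarrow> y \<in> topspace X \<Longrightarrow> dv x (mul x y) = y"
    by (rule rectifiable_space_operations[OF assms(1)]) (rule that)
  interpret rectifiable_k_network_space X N e mul dv
  proof
    show "locally_finite_seq X F"
      if "\<And>n. finite (F n)" "\<And>n. F n \<subseteq> topspace X" "compact_finite_seq X F" for F
      by (rule compact_finite_imp_locally_finite[OF assms(2,5) that])
  qed (fact ops assms(4))+
  show ?thesis
  proof (cases "\<exists>d. cofan e d")
    case True
    then have "\<not> semifan s" for s using not_cofan_semifan by blast
    then show ?thesis using no_semifan_metrizable by blast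
  next
    case False
    interpret compact_k_network_space X N
    proof
      show "k_real_space X" by (rule assms(4))
      show "\<exists>F. finite F \<and> F \<subseteq> (\<Union>i. N i) \<and> (\<forall>A\<in>F. x \<in> A \<and> compactin X A) \<and>
        (\<forall>\<^sub>F n in sequentially. \<sigma> n \<in> \<Union>F)" if "limitin X \<sigma> x sequentially" for \<sigma> x
        by (rule no_cofan_compact_cover[OF _ that]) (use False in blast)
    qed
    show ?thesis using sum_of_cosmic_k_omega ..
  qed
qed

end
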